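(* Let $T$ be a polygonal transformation in $\mathbb{P}^1$ admitting a linear scaling symmetry. Let $P$ be a (twisted or closed) $n$-gon in $\mathbb{P}^1$. For $0\leq k\leq\lfloor n/2\rfloor$, define $$H_k=\sum_{\substack{I\ \text{cyclically sparse}\\ |I|\geq k}}(-1)^{|I|}c_I\sum_{\substack{J\subset I\\ |J|=k}}\frac{c_J'}{c_J}.$$ These quantities are preserved by the dynamic and are projective invariant. Moreover, for every $t\in\mathbb{G}_m$, $$\mathrm{Tr}(M(t))=\sum_{k=0}^{\lfloor n/2\rfloor}H_k\,(t-1)^k.$$
   Context: Let $F$ be a field, $\mathbb{P}^1=\mathbb{P}^1(F)$, $\mathrm{PGL}_2=\mathrm{GL}_2(F)/F^*$, $\mathbb{G}_m=F^*$ (as algebraic group). A (twisted) $n$-gon in $\mathbb{P}^1$ is $P=((p_i)_{i\in\mathbb{Z}},M)$ with $p_i\in\mathbb{P}^1$, monodromy $M\in\mathrm{PGL}_2$, $p_{i+n}=Mp_i$, such that $p_i,p_{i+1},p_{i+2}$ are pairwise distinct for every $i$; it is closed if $M=\mathrm{Id}$. $\mathrm{PGL}_2$ acts on the space $\tilde{\mathcal T}_n$ of $n$-gons by $A\cdot P=((Ap_i),AMA^{-1})$, with quotient (moduli space) $\mathcal T_n$ and class $[P]$. A polygonal transformation is a birational map $T:\tilde{\mathcal T}_n\dashrightarrow\tilde{\mathcal T}_n$ commuting with this action; it induces a birational map of $\mathcal T_n$, also denoted $T$. The cross-ratio coordinates of $P$ are the $n$-periodic sequence $c_i=\frac{p_i-p_{i-1}}{p_i-p_{i+2}}\cdot\frac{p_{i+1}-p_{i+2}}{p_{i+1}-p_{i-1}}$,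 which determines $[P]$. A scaling symmetry is a non-trivial action $\rho:\mathbb{G}_m\times\mathcal T_n\to\mathcal T_n$, $(t,[P])\mapsto[P]_t$, of the algebraic group $\mathbb{G}_m$ (rational in $t$ and the $c_i$, undefined where the deformed polygon degenerates) commuting with $T$; $c_i(t)$ denotes the cross-ratio coordinates of $[P]_t$ and $'$ the derivative in $t$. It is linear if $c_i(t)=c_i(1)+c_i'(1)(t-1)$ for all $i$. For $I\subset\{1,\dots,n\}$ put $c_I=\prod_{i\in I}c_i(1)$ and $c'_I=\prod_{i\in I}c_i'(1)$. $I$ is cyclically sparse if it contains no pair of consecutive indices modulo $n$. $M(t)$ is the monodromy of a lift $P_t$ of $[P]_t$ (with $P_1=P$), represented, up to conjugation (placing $p_0,p_1,p_2$ at $1,\infty,0$), by the matrix $M(t)=L_1(t)\cdots L_n(t)$ with $L_i(t)=\begin{pmatrix}0&c_i(t)\\-1&1\end{pmatrix}$.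
   Formalization: "Preserved by the dynamic" is shown only if T also preserves the matrix L_1...L_n up to conjugation in GL_2; without this it fails: T fixing p_0,p_1,p_2 and scaling all c_i by a constant commutes with c_i(t)=t c_i but changes H_0. *)

theory Defs
  imports "HOL-Analysis.Analysis" "HOL-Computational_Algebra.Polynomial"
begin

text \<open>
  The base field \<open>F\<close> is the type \<open>'a\<close>. Geometric objects are taken over a field \<open>K\<close>
  (the type \<open>'k\<close>) together with an embedding \<open>\<iota>\<close> of \<open>F\<close> into \<open>K\<close>. Rational maps are
  partial functions on \<open>K\<close>-points given locally by polynomials with coefficients in \<open>F\<close>. This is
  adequate as soon as \<open>K\<close> is infinite: \<open>K = F\<close> if \<open>F\<close> is infinite, and the algebraic closure of
  \<open>F\<close> in every case. On the points of a finite field, polynomials and rational maps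
  would not be determined by their values.
\<close>

definition field_embedding :: "('a::field \<Rightarrow> 'k::field) \<Rightarrow> bool" where
  "field_embedding \<iota> \<longleftrightarrow>
     \<iota> 1 = 1 \<and> (\<forall>a b. \<iota> (a + b) = \<iota> a + \<iota> b) \<and> (\<forall>a b. \<iota> (a * b) = \<iota> a * \<iota> b)"


subsection \<open>The projective line and its projective transformations\<close>

definition proportional :: "'k::field ^ 2 \<Rightarrow> 'k ^ 2 \<Rightarrow> bool" where
  "proportional u v \<longleftrightarrow> u \<noteq> 0 \<and> v \<noteq> 0 \<and> (\<exists>k. k \<noteq> 0 \<and> v = k *s u)"

lemma part_equivp_proportional: "part_equivp (proportional :: 'k::field ^ 2 \<Rightarrow> _)"
proof (rule part_equivpI)
  have "proportional (axis 1 (1::'k)) (axis 1 1)"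
    unfolding proportional_def by (intro conjI exI[of _ 1]) (auto simp: axis_eq_0_iff)
  then show "\<exists>v :: 'k ^ 2. proportional v v" by blast
  show "symp (proportional :: 'k ^ 2 \<Rightarrow> _)"
  proof (rule sympI)
    fix u v :: "'k ^ 2"
    assume "proportional u v"
    then obtain k where k: "u \<noteq> 0" "v \<noteq> 0" "k \<noteq> 0" "v = k *s u"
      by (auto simp: proportional_def)
    then have "u = inverse k *s v" by (simp add: vector_smult_assoc)
    with k show "proportional v u"
      unfolding proportional_def using nonzero_imp_inverse_nonzero by blast
  qed
  show "transp (proportional :: 'k ^ 2 \<Rightarrow> _)"
  proof (rule transpI)
    fix u v w :: "'k ^ 2"
    assume "proportional u v" "proportional v w"
    then obtain k l where "u \<noteq> 0" "w \<noteq> 0" "k \<noteq> 0" "l \<noteq> 0" "v = k *s u" "w = l *s v"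
      by (auto simp: proportional_def)
    then show "proportional u w"
      unfolding proportional_def
      by (intro conjI exI[of _ "l * k"]) (auto simp: vector_smult_assoc)
  qed
qed

quotient_type (overloaded) 'k P1 = "'k::field ^ 2" / partial: proportional
  by (rule part_equivp_proportional)

definition smat :: "'k::field \<Rightarrow> 'k ^ 2 ^ 2 \<Rightarrow> 'k ^ 2 ^ 2" where
  "smat k A = (\<chi> i j. k * A $ i $ j)"

definition mat_proportional :: "'k::field ^ 2 ^ 2 \<Rightarrow> 'k ^ 2 ^ 2 \<Rightarrow> bool" where
  "mat_proportional A B \<longleftrightarrow> invertible A \<and> invertible B \<and> (\<exists>k. k \<noteq> 0 \<and> B = smat k A)"

lemma smat_mult: "smat k A ** B = smat k (A ** B)" "A ** smat k B = smat k (A ** B)"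
  by (simp_all add: smat_def matrix_matrix_mult_def vec_eq_iff sum_2 algebra_simps)

lemma smat_smat: "smat k (smat l A) = smat (k * l) A"
  by (simp add: smat_def vec_eq_iff algebra_simps)

lemma smat_one: "smat 1 A = A"
  by (simp add: smat_def vec_eq_iff)

lemma smat_vector: "smat k A *v v = k *s (A *v v)"
  by (simp add: smat_def matrix_vector_mult_def vec_eq_iff sum_2 algebra_simps)

lemma part_equivp_mat_proportional: "part_equivp (mat_proportional :: 'k::field ^ 2 ^ 2 \<Rightarrow> _)"
proof (rule part_equivpI)
  have "mat_proportional (mat 1 :: 'k ^ 2 ^ 2) (mat 1)"
    unfolding mat_proportional_def
    by (intro conjI exI[of _ 1]) (auto simp: smat_one invertible_def intro!: exI[of _ "mat 1"])
  then show "\<exists>A :: 'k ^ 2 ^ 2. mat_proportional A A" by blast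
  show "symp (mat_proportional :: 'k ^ 2 ^ 2 \<Rightarrow> _)"
  proof (rule sympI)
    fix A B :: "'k ^ 2 ^ 2"
    assume "mat_proportional A B"
    then obtain k where k: "invertible A" "invertible B" "k \<noteq> 0" "B = smat k A"
      by (auto simp: mat_proportional_def)
    then have "A = smat (inverse k) B" by (simp add: smat_smat smat_one)
    with k show "mat_proportional B A"
      unfolding mat_proportional_def using nonzero_imp_inverse_nonzero by blast
  qed
  show "transp (mat_proportional :: 'k ^ 2 ^ 2 \<Rightarrow> _)"
  proof (rule transpI)
    fix A B C :: "'k ^ 2 ^ 2"
    assume "mat_proportional A B" "mat_proportional B C"
    then obtain k l where "invertible A" "invertible C" "k \<noteq> 0" "l \<noteq> 0"
        "B = smat k A" "C = smat l B"
      by (auto simp: mat_proportional_def)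
    then show "mat_proportional A C"
      unfolding mat_proportional_def
      by (intro conjI exI[of _ "l * k"]) (auto simp: smat_smat)
  qed
qed

quotient_type (overloaded) 'k PGL2 = "'k::field ^ 2 ^ 2" / partial: mat_proportional
  by (rule part_equivp_mat_proportional)

lemma invertible_mult_eq_0:
  fixes A :: "'k::field ^ 2 ^ 2"
  assumes "invertible A" "A *v u = 0"
  shows "u = 0"
proof -
  obtain B where "B ** A = mat 1" using assms(1) unfolding invertible_def by blast
  then have "u = B *v (A *v u)" by (simp add: matrix_vector_mul_assoc)
  then show ?thesis using assms(2) by simp
qed

lift_definition pgl_act :: "'k::field PGL2 \<Rightarrow> 'k P1 \<Rightarrow> 'k P1"
  is "\<lambda>A v. A *v v"
proof -
  fix A B :: "'k ^ 2 ^ 2" and u v :: "'k ^ 2"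
  assume "mat_proportional A B" "proportional u v"
  then obtain k l where kl: "invertible A" "invertible B" "k \<noteq> 0" "B = smat k A"
      "u \<noteq> 0" "v \<noteq> 0" "l \<noteq> 0" "v = l *s u"
    by (auto simp: mat_proportional_def proportional_def)
  then have "B *v v = (k * l) *s (A *v u)"
    by (simp add: smat_vector vector_scalar_commute vector_smult_assoc)
  with kl show "proportional (A *v u) (B *v v)"
    unfolding proportional_def using invertible_mult_eq_0 by (metis no_zero_divisors)
qed

lemma matrix_inv_props:
  fixes A :: "'k::field ^ 2 ^ 2"
  assumes "invertible A"
  shows "A ** matrix_inv A = mat 1" "matrix_inv A ** A = mat 1" "invertible (matrix_inv A)"
proof -
  show 1: "A ** matrix_inv A = mat 1" and 2: "matrix_inv A ** A = mat 1"
    using someI_ex[of "\<lambda>A'. A ** A' = mat 1 \<and> A' ** A = mat 1"] assms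
    unfolding invertible_def matrix_inv_def by auto
  show "invertible (matrix_inv A)"
    using 1 2 unfolding invertible_def by blast
qed

lemma matrix_inv_smat:
  fixes A :: "'k::field ^ 2 ^ 2"
  assumes "invertible A" "k \<noteq> 0"
  shows "matrix_inv (smat k A) = smat (inverse k) (matrix_inv A)"
proof -
  have 1: "smat k A ** smat (inverse k) (matrix_inv A) = mat 1"
    and 2: "smat (inverse k) (matrix_inv A) ** smat k A = mat 1"
    using assms by (simp_all add: smat_mult smat_smat matrix_inv_props smat_one)
  then have "invertible (smat k A)" unfolding invertible_def by blast
  from matrix_inv_props(2)[OF this] 1 show ?thesis
    by (metis matrix_mul_assoc matrix_mul_lid matrix_mul_rid)
qed

lift_definition pgl_conj :: "'k::field PGL2 \<Rightarrow> 'k PGL2 \<Rightarrow> 'k PGL2"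
  is "\<lambda>A M. A ** M ** matrix_inv A"
proof -
  fix A B M N :: "'k ^ 2 ^ 2"
  assume "mat_proportional A B" "mat_proportional M N"
  then obtain k l where kl: "invertible A" "invertible B" "k \<noteq> 0" "B = smat k A"
      "invertible M" "invertible N" "l \<noteq> 0" "N = smat l M"
    by (auto simp: mat_proportional_def)
  then have "B ** N ** matrix_inv B = smat l (A ** M ** matrix_inv A)"
    by (simp add: smat_mult smat_smat matrix_inv_smat mult.left_commute[of _ l])
  with kl show "mat_proportional (A ** M ** matrix_inv A) (B ** N ** matrix_inv B)"
    unfolding mat_proportional_def
    by (metis invertible_mult matrix_inv_props(3))
qed

text \<open>
  For points with affine coordinates \<open>x\<^sub>1 / x\<^sub>2\<close> and \<open>y\<^sub>1 / y\<^sub>2\<close>, \<open>bracket x y\<close> is the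
  difference of the coordinates times \<open>x\<^sub>2 y\<^sub>2\<close>; these factors cancel in cross-ratios.
\<close>

definition bracket :: "'k::field ^ 2 \<Rightarrow> 'k ^ 2 \<Rightarrow> 'k" where
  "bracket x y = x $ 1 * y $ 2 - y $ 1 * x $ 2"

lift_definition cross :: "'k::field P1 \<Rightarrow> 'k P1 \<Rightarrow> 'k P1 \<Rightarrow> 'k P1 \<Rightarrow> 'k"
  is "\<lambda>a b c d. bracket b a / bracket b d * (bracket c d / bracket c a)"
proof -
  fix a a' b b' c c' d d' :: "'k ^ 2"
  assume "proportional a a'" "proportional b b'" "proportional c c'" "proportional d d'"
  then obtain k l m q where *: "k \<noteq> 0" "l \<noteq> 0" "m \<noteq> 0" "q \<noteq> 0"
      "a' = k *s a" "b' = l *s b" "c' = m *s c" "d' = q *s d"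
    by (auto simp: proportional_def)
  have scale: "bracket (r *s x) (s *s y) = r * s * bracket x y" for r s and x y :: "'k ^ 2"
    by (simp add: bracket_def algebra_simps)
  show "bracket b a / bracket b d * (bracket c d / bracket c a) =
        bracket b' a' / bracket b' d' * (bracket c' d' / bracket c' a')"
    using * by (simp add: scale)
qed


subsection \<open>Polygons and their moduli space\<close>

type_synonym 'k ngon = "(int \<Rightarrow> 'k P1) \<times> 'k PGL2"

definition ngons :: "nat \<Rightarrow> 'k::field ngon set" where
  "ngons n = {(p, M).
     (\<forall>i. p (i + int n) = pgl_act M (p i)) \<and>
     (\<forall>i. p i \<noteq> p (i + 1) \<and> p (i + 1) \<noteq> p (i + 2) \<and> p i \<noteq> p (i + 2))}"

definition act :: "'k::field PGL2 \<Rightarrow> 'k ngon \<Rightarrow> 'k ngon" where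
  "act A P = (\<lambda>i. pgl_act A (fst P i), pgl_conj A (snd P))"

definition mclass :: "'k::field ngon \<Rightarrow> 'k ngon set" where
  "mclass P = {act A P | A. True}"

definition moduli :: "nat \<Rightarrow> 'k::field ngon set set" where
  "moduli n = mclass ` ngons n"

definition cross_ratio :: "'k::field ngon \<Rightarrow> int \<Rightarrow> 'k" where
  "cross_ratio P i = cross (fst P (i - 1)) (fst P i) (fst P (i + 1)) (fst P (i + 2))"

definition class_cross_ratio :: "'k::field ngon set \<Rightarrow> int \<Rightarrow> 'k" where
  "class_cross_ratio x = cross_ratio (SOME P. P \<in> x)"


subsection \<open>Rational maps\<close>

text \<open>The \<open>F\<close>-algebra of functions generated by a set \<open>X\<close> of coordinate functions.\<close>

inductive_set polyfuns :: "('a::field \<Rightarrow> 'k::field) \<Rightarrow> ('s \<Rightarrow> 'k) set \<Rightarrow> ('s \<Rightarrow> 'k) set"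
  for \<iota> X where
  const: "(\<lambda>_. \<iota> a) \<in> polyfuns \<iota> X"
| coord: "f \<in> X \<Longrightarrow> f \<in> polyfuns \<iota> X"
| add: "f \<in> polyfuns \<iota> X \<Longrightarrow> g \<in> polyfuns \<iota> X \<Longrightarrow> (\<lambda>x. f x + g x) \<in> polyfuns \<iota> X"
| mult: "f \<in> polyfuns \<iota> X \<Longrightarrow> g \<in> polyfuns \<iota> X \<Longrightarrow> (\<lambda>x. f x * g x) \<in> polyfuns \<iota> X"

text \<open>
  An \<open>n\<close>-gon is determined by \<open>p\<^sub>0, \<dots>, p\<^sub>n\<^sub>-\<^sub>1\<close> and \<open>M\<close>, so that \<open>n\<close>-gons form an open subset of
  the product of \<open>n\<close> projective lines with \<open>PGL\<^sub>2\<close>, on which we use homogeneous coordinates.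
\<close>

type_synonym 'k hcoords = "(int \<Rightarrow> 'k ^ 2) \<times> ('k ^ 2 ^ 2)"

definition hcoords_of :: "nat \<Rightarrow> 'k::field ngon \<Rightarrow> 'k hcoords set" where
  "hcoords_of n P = {(v, N).
     (\<forall>i\<in>{0..<int n}. v i \<noteq> 0 \<and> fst P i = abs_P1 (v i)) \<and>
     invertible N \<and> snd P = abs_PGL2 N}"

definition hcoord_funs :: "nat \<Rightarrow> ('k::field hcoords \<Rightarrow> 'k) set" where
  "hcoord_funs n =
     {\<lambda>(v, N). v i $ j | i j. i \<in> {0..<int n}} \<union> {\<lambda>(v, N). N $ i $ j | i j. True}"

definition polynomial_hmap ::
    "('a::field \<Rightarrow> 'k::field) \<Rightarrow> nat \<Rightarrow> ('k hcoords \<Rightarrow> 'k hcoords) \<Rightarrow> bool" where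
  "polynomial_hmap \<iota> n f \<longleftrightarrow> (\<forall>h\<in>hcoord_funs n. h \<circ> f \<in> polyfuns \<iota> (hcoord_funs n))"

text \<open>
  A rational map is a partial function with non-empty domain that, around each point of its domain,
  is given by polynomials in the homogeneous coordinates; it is defined, with this value, wherever
  the polynomials yield a non-degenerate polygon. Thus the domain is Zariski open, and dense
  because the space of \<open>n\<close>-gons is irreducible.
\<close>

definition rational_map :: "('a::field \<Rightarrow> 'k::field) \<Rightarrow> nat \<Rightarrow> ('k ngon \<rightharpoonup> 'k ngon) \<Rightarrow> bool" where
  "rational_map \<iota> n T \<longleftrightarrow>
     dom T \<noteq> {} \<and> dom T \<subseteq> ngons n \<and> ran T \<subseteq> ngons n \<and>
     (\<forall>P\<in>dom T. \<exists>f. polynomial_hmap \<iota> n f \<and>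
        (\<exists>x\<in>hcoords_of n P. \<exists>R\<in>ngons n. f x \<in> hcoords_of n R) \<and>
        (\<forall>Q\<in>ngons n. \<forall>x\<in>hcoords_of n Q. \<forall>R\<in>ngons n.
           f x \<in> hcoords_of n R \<longrightarrow> T Q = Some R))"

definition birational_map :: "('a::field \<Rightarrow> 'k::field) \<Rightarrow> nat \<Rightarrow> ('k ngon \<rightharpoonup> 'k ngon) \<Rightarrow> bool" where
  "birational_map \<iota> n T \<longleftrightarrow> rational_map \<iota> n T \<and>
     (\<exists>S. rational_map \<iota> n S \<and>
        dom (S \<circ>\<^sub>m T) \<noteq> {} \<and> (\<forall>P Q. (S \<circ>\<^sub>m T) P = Some Q \<longrightarrow> Q = P) \<and>
        dom (T \<circ>\<^sub>m S) \<noteq> {} \<and> (\<forall>P Q. (T \<circ>\<^sub>m S) P = Some Q \<longrightarrow> Q = P))"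

definition polygonal_transformation ::
    "('a::field \<Rightarrow> 'k::field) \<Rightarrow> nat \<Rightarrow> ('k ngon \<rightharpoonup> 'k ngon) \<Rightarrow> bool" where
  "polygonal_transformation \<iota> n T \<longleftrightarrow> birational_map \<iota> n T \<and>
     (\<forall>A P. P \<in> dom T \<and> act A P \<in> dom T \<longrightarrow> T (act A P) = Some (act A (the (T P))))"

definition induced :: "('k::field ngon \<rightharpoonup> 'k ngon) \<Rightarrow> ('k ngon set \<rightharpoonup> 'k ngon set)" where
  "induced T x =
     (if x \<inter> dom T = {} then None else Some (mclass (the (T (SOME P. P \<in> x \<inter> dom T)))))"


subsection \<open>Scaling symmetries\<close>

text \<open>
  The cross-ratio coordinates identify the moduli space with the space of \<open>n\<close>-periodic sequences of
  non-zero scalars. A rational map from the product of the multiplicative group and the moduli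
  space to the moduli space is given locally by quotients of polynomials in \<open>t, c\<^sub>1, \<dots>, c\<^sub>n\<close>; it is
  defined wherever these take finite non-zero values.
\<close>

definition tc_funs :: "nat \<Rightarrow> ('k::field \<times> (int \<Rightarrow> 'k) \<Rightarrow> 'k) set" where
  "tc_funs n = {\<lambda>(t, c). t} \<union> {\<lambda>(t, c). c i | i. i \<in> {1..int n}}"

definition rational_family ::
    "('a::field \<Rightarrow> 'k::field) \<Rightarrow> nat \<Rightarrow> ('k \<Rightarrow> 'k ngon set \<rightharpoonup> 'k ngon set) \<Rightarrow> bool" where
  "rational_family \<iota> n \<rho> \<longleftrightarrow>
     (\<exists>t x. \<rho> t x \<noteq> None) \<and>
     (\<forall>t x y. \<rho> t x = Some y \<longrightarrow> t \<noteq> 0 \<and> x \<in> moduli n \<and> y \<in> moduli n) \<and>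
     (\<forall>t x. \<rho> t x \<noteq> None \<longrightarrow>
        (\<exists>N D. (\<forall>i\<in>{1..int n}. N i \<in> polyfuns \<iota> (tc_funs n) \<and> D i \<in> polyfuns \<iota> (tc_funs n)) \<and>
           (\<forall>i\<in>{1..int n}. N i (t, class_cross_ratio x) \<noteq> 0 \<and> D i (t, class_cross_ratio x) \<noteq> 0) \<and>
           (\<forall>s y. s \<noteq> 0 \<and> y \<in> moduli n \<and>
              (\<forall>i\<in>{1..int n}. N i (s, class_cross_ratio y) \<noteq> 0 \<and> D i (s, class_cross_ratio y) \<noteq> 0)
              \<longrightarrow> (\<exists>z. \<rho> s y = Some z \<and>
                    (\<forall>i\<in>{1..int n}. class_cross_ratio z i =
                        N i (s, class_cross_ratio y) / D i (s, class_cross_ratio y))))))"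

definition rational_action ::
    "('a::field \<Rightarrow> 'k::field) \<Rightarrow> nat \<Rightarrow> ('k \<Rightarrow> 'k ngon set \<rightharpoonup> 'k ngon set) \<Rightarrow> bool" where
  "rational_action \<iota> n \<rho> \<longleftrightarrow> rational_family \<iota> n \<rho> \<and>
     (\<exists>x. \<rho> 1 x \<noteq> None) \<and> (\<forall>x y. \<rho> 1 x = Some y \<longrightarrow> y = x) \<and>
     (\<forall>s t x y z w. \<rho> t x = Some y \<and> \<rho> s y = Some z \<and> \<rho> (s * t) x = Some w \<longrightarrow> z = w)"

definition scaling_symmetry ::
    "('a::field \<Rightarrow> 'k::field) \<Rightarrow> nat \<Rightarrow> ('k ngon \<rightharpoonup> 'k ngon) \<Rightarrow>
     ('k \<Rightarrow> 'k ngon set \<rightharpoonup> 'k ngon set) \<Rightarrow> bool" where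
  "scaling_symmetry \<iota> n T \<rho> \<longleftrightarrow> rational_action \<iota> n \<rho> \<and>
     (\<exists>t x y. \<rho> t x = Some y \<and> y \<noteq> x) \<and>
     (\<forall>t x y y'. (induced T \<circ>\<^sub>m \<rho> t) x = Some y \<and> (\<rho> t \<circ>\<^sub>m induced T) x = Some y' \<longrightarrow> y = y')"

text \<open>\<open>deformed \<rho> P i t\<close> is \<open>c\<^sub>i(t)\<close>.\<close>

definition deformed ::
    "('k::field \<Rightarrow> 'k ngon set \<rightharpoonup> 'k ngon set) \<Rightarrow> 'k ngon \<Rightarrow> int \<Rightarrow> 'k \<Rightarrow> 'k" where
  "deformed \<rho> P i t = class_cross_ratio (the (\<rho> t (mclass P))) i"

text \<open>
  The algebraic derivative at \<open>t\<^sub>0\<close> of a function that is given on \<open>D\<close> by a rational function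
  regular at \<open>t\<^sub>0\<close>. The rational function is unique when \<open>D\<close> is infinite.
\<close>

definition rat_deriv :: "'k::field set \<Rightarrow> ('k \<Rightarrow> 'k) \<Rightarrow> 'k \<Rightarrow> 'k" where
  "rat_deriv D g t\<^sub>0 = (THE d. \<exists>p q. poly q t\<^sub>0 \<noteq> 0 \<and>
     (\<forall>t\<in>D. poly q t \<noteq> 0 \<longrightarrow> g t = poly p t / poly q t) \<and>
     d = poly (pderiv p * q - p * pderiv q) t\<^sub>0 / (poly q t\<^sub>0)\<^sup>2)"

definition deformed_deriv ::
    "('k::field \<Rightarrow> 'k ngon set \<rightharpoonup> 'k ngon set) \<Rightarrow> 'k ngon \<Rightarrow> int \<Rightarrow> 'k \<Rightarrow> 'k" where
  "deformed_deriv \<rho> P i = rat_deriv {t. \<rho> t (mclass P) \<noteq> None} (deformed \<rho> P i)"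

definition linear_symmetry ::
    "nat \<Rightarrow> ('k::field \<Rightarrow> 'k ngon set \<rightharpoonup> 'k ngon set) \<Rightarrow> bool" where
  "linear_symmetry n \<rho> \<longleftrightarrow>
     (\<forall>P\<in>ngons n. \<forall>t. \<rho> 1 (mclass P) \<noteq> None \<and> \<rho> t (mclass P) \<noteq> None \<longrightarrow>
        (\<forall>i. deformed \<rho> P i t = deformed \<rho> P i 1 + deformed_deriv \<rho> P i 1 * (t - 1)))"


subsection \<open>Monodromy matrices and the conserved quantities\<close>

text \<open>
  \<open>monodromy_matrix n P\<close> is the product of the \<open>L_matrix c\<^sub>i\<close> for \<open>i = 1, \<dots>, n\<close>. It represents the
  monodromy of the polygon projectively equivalent to \<open>P\<close> with \<open>p\<^sub>0, p\<^sub>1, p\<^sub>2\<close> at \<open>1, \<infinity>, 0\<close>.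
\<close>

definition L_matrix :: "'k::field \<Rightarrow> 'k ^ 2 ^ 2" where
  "L_matrix c = vector [vector [0, c], vector [- 1, 1]]"

definition monodromy_matrix :: "nat \<Rightarrow> 'k::field ngon \<Rightarrow> 'k ^ 2 ^ 2" where
  "monodromy_matrix n P =
     foldr (\<lambda>i A. L_matrix (cross_ratio P i) ** A) [1..int n] (mat 1)"

text \<open>
  A polygonal transformation need not preserve the monodromy: the map that fixes
  \<open>p\<^sub>0, p\<^sub>1, p\<^sub>2\<close> and multiplies all cross-ratio coordinates by a constant other than \<open>0\<close> and \<open>1\<close> is
  one, and it commutes with the linear scaling symmetry \<open>c\<^sub>i(t) = t c\<^sub>i\<close>. Preserving the monodromy only up to scalars, as an element of \<open>PGL\<^sub>2\<close>, does
  not preserve traces either. We therefore use the conjugacy class of the normalised matrix.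
\<close>

definition preserves_monodromy :: "nat \<Rightarrow> ('k::field ngon \<rightharpoonup> 'k ngon) \<Rightarrow> bool" where
  "preserves_monodromy n T \<longleftrightarrow> (\<forall>P Q. T P = Some Q \<longrightarrow>
     (\<exists>A. invertible A \<and> monodromy_matrix n Q = A ** monodromy_matrix n P ** matrix_inv A))"

definition cyclically_sparse :: "nat \<Rightarrow> int set \<Rightarrow> bool" where
  "cyclically_sparse n I \<longleftrightarrow>
     I \<subseteq> {1..int n} \<and> \<not> (\<exists>i\<in>I. \<exists>j\<in>I. j mod int n = (i + 1) mod int n)"

definition H_sum :: "nat \<Rightarrow> ('k::field \<Rightarrow> 'k ngon set \<rightharpoonup> 'k ngon set) \<Rightarrow> nat \<Rightarrow> 'k ngon \<Rightarrow> 'k" where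
  "H_sum n \<rho> k P =
     (\<Sum>I\<in>{I. cyclically_sparse n I \<and> k \<le> card I}.
        (- 1) ^ card I * (\<Prod>i\<in>I. deformed \<rho> P i 1) *
        (\<Sum>J\<in>{J. J \<subseteq> I \<and> card J = k}.
           (\<Prod>i\<in>J. deformed_deriv \<rho> P i 1) / (\<Prod>i\<in>J. deformed \<rho> P i 1)))"

end

theory Submission
  imports Defs
begin

text \<open>
  The quantities \<open>H_sum n \<rho> k P\<close> are the coefficients of a polynomial in \<open>t - 1\<close>, the trace of the
  normalised monodromy of the deformed polygon; all three claims come from this.

  \<^bold>\<open>The trace formula.\<close> The entries of a product of matrices \<open>L_matrix c\<^sub>i\<close> satisfy a
  second-order recurrence, which is also the recurrence of signed sums of the products \<open>c\<^sub>I\<close> over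
  sparse sets \<open>I\<close> of indices (\<open>signed_sum_sparse_rec\<close>). Closing the chain up to a cycle shows that
  the trace is the sum of \<open>(- 1) ^ card I * c\<^sub>I\<close> over cyclically sparse \<open>I\<close> (\<open>trace_frame\<close>). A linear
  symmetry replaces \<open>c\<^sub>i\<close> by \<open>c\<^sub>i + c'\<^sub>i (t - 1)\<close>, and expanding each product in powers of
  \<open>t - 1\<close> yields the sums over \<open>J \<subseteq> I\<close> in the definition of \<open>H_sum\<close> (\<open>signed_sum_expansion\<close>).

  \<^bold>\<open>Projective invariance.\<close> Everything is computed from the class of the polygon.

  \<^bold>\<open>Conservation.\<close> Let \<open>Q = T P\<close>, where \<open>T\<close> preserves the conjugacy class of the
  normalised monodromy. As \<open>T\<close> commutes with the deformation, it maps the deformations of \<open>P\<close> to those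
  of \<open>Q\<close>; so their monodromies have equal trace, and comparing coefficients gives the claim. All maps are only partial, however, so
  the equality of traces holds for those \<open>t\<close> at which all of them are defined. As the field is
  infinite, it is enough that only finitely many \<open>t\<close> are excluded. For the deformation this follows
  from its definition as a rational family. For \<open>T\<close> one has to know that it remains defined on
  the deformed classes for almost every \<open>t\<close> (\<open>cofinitely_defined\<close>). A polygon whose first three
  vertices are \<open>1\<close>, \<open>\<infinity>\<close>, \<open>0\<close> has homogeneous coordinates polynomial in its cross-ratios
  (\<open>normal_form\<close>), hence polynomial in \<open>t\<close> along the deformation; and \<open>T\<close> is given around \<open>P\<close> by
  polynomials in these coordinates, which yield a polygon as long as finitely many polynomials
  in \<open>t\<close>, nonzero at \<open>t = 1\<close>, do not vanish.
\<close>


section \<open>The projective action on points, polygons and classes\<close>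

lemma bracket_mult: "bracket (A *v u) (A *v v) = det A * bracket u v"
  for A :: "'k::field ^ 2 ^ 2"
  by (simp add: bracket_def matrix_vector_mult_def sum_2 det_2 algebra_simps)

lemma bracket_zero [simp]: "bracket 0 v = 0" "bracket u 0 = 0" "bracket u u = 0"
  by (simp_all add: bracket_def)

lemma bracket_commute_zero: "bracket v u = 0 \<longleftrightarrow> bracket u v = 0"
  by (auto simp: bracket_def)

lemma proportional_iff: "proportional u v \<longleftrightarrow> u \<noteq> 0 \<and> v \<noteq> 0 \<and> bracket u v = 0"
proof
  assume "proportional u v"
  then show "u \<noteq> 0 \<and> v \<noteq> 0 \<and> bracket u v = 0"
    by (auto simp: proportional_def bracket_def)
next
  assume *: "u \<noteq> 0 \<and> v \<noteq> 0 \<and> bracket u v = 0"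
  have "\<exists>k. v = k *s u"
  proof (cases "u $ 1 = 0")
    case True
    with * have "u $ 2 \<noteq> 0" "v $ 1 = 0" by (auto simp: vec_eq_iff forall_2 bracket_def)
    with True show ?thesis
      by (intro exI[of _ "v $ 2 / u $ 2"]) (auto simp: vec_eq_iff forall_2)
  next
    case False
    with * show ?thesis
      by (intro exI[of _ "v $ 1 / u $ 1"]) (auto simp: vec_eq_iff forall_2 bracket_def field_simps)
  qed
  then obtain k where "v = k *s u" by blast
  moreover from this * have "k \<noteq> 0" by auto
  ultimately show "proportional u v" using * by (auto simp: proportional_def)
qed

lemma abs_P1_eq_iff:
  assumes "u \<noteq> 0" "v \<noteq> 0"
  shows "abs_P1 u = abs_P1 v \<longleftrightarrow> bracket u v = 0"
  using Quotient3_rel[OF Quotient3_P1, of u v] assms by (auto simp: proportional_iff)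

lemma P1_cases: obtains v where "v \<noteq> 0" "x = abs_P1 v"
  by (induction x rule: P1.abs_induct) (auto simp: proportional_iff)

lemma mat_proportional_refl: "mat_proportional A A \<longleftrightarrow> invertible A"
  unfolding mat_proportional_def using smat_one by (metis one_neq_zero)

lemma PGL2_cases: obtains A where "invertible A" "X = abs_PGL2 A"
  by (induction X rule: PGL2.abs_induct) (auto simp: mat_proportional_refl)

lemma abs_PGL2_smat:
  assumes "invertible A" "k \<noteq> 0"
  shows "invertible (smat k A)" "abs_PGL2 (smat k A) = abs_PGL2 A"
proof -
  have "det (smat k A) = k * k * det A" by (simp add: det_2 smat_def algebra_simps)
  with assms show *: "invertible (smat k A)" by (simp add: invertible_det_nz)
  show "abs_PGL2 (smat k A) = abs_PGL2 A"
    using Quotient3_rel[OF Quotient3_PGL2, of A "smat k A"] assms * 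
    by (auto simp: mat_proportional_refl mat_proportional_def)
qed

lemma abs_PGL2_eqD:
  assumes "invertible A" "invertible B" "abs_PGL2 A = abs_PGL2 B"
  obtains k where "k \<noteq> 0" "B = smat k A"
  using Quotient3_rel[OF Quotient3_PGL2, of A B] assms
  by (auto simp: mat_proportional_refl mat_proportional_def)

lemma pgl_act_abs:
  assumes "invertible A" "v \<noteq> 0"
  shows "pgl_act (abs_PGL2 A) (abs_P1 v) = abs_P1 (A *v v)" "A *v v \<noteq> 0"
  using assms invertible_mult_eq_0
  by (auto simp: pgl_act.abs_eq mat_proportional_refl proportional_iff)

lemma pgl_conj_abs:
  assumes "invertible A" "invertible M"
  shows "pgl_conj (abs_PGL2 A) (abs_PGL2 M) = abs_PGL2 (A ** M ** matrix_inv A)"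
  using assms by (auto simp: pgl_conj.abs_eq mat_proportional_refl)

lemma cross_abs:
  assumes "a \<noteq> 0" "b \<noteq> 0" "c \<noteq> 0" "d \<noteq> 0"
  shows "cross (abs_P1 a) (abs_P1 b) (abs_P1 c) (abs_P1 d) =
    bracket b a / bracket b d * (bracket c d / bracket c a)"
  using assms by (auto simp: cross.abs_eq proportional_iff)

lemma matrix_inv_unique:
  assumes "A ** B = mat 1" "B ** A = mat 1"
  shows "matrix_inv A = (B :: 'k::field ^ 2 ^ 2)"
proof -
  have "invertible A" using assms unfolding invertible_def by blast
  from matrix_inv_props[OF this] assms show ?thesis
    by (metis matrix_mul_assoc matrix_mul_lid matrix_mul_rid)
qed

lemma matrix_inv_cancel:
  fixes A X :: "'k::field ^ 2 ^ 2"
  assumes "invertible A"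
  shows "X ** A ** matrix_inv A = X" "X ** matrix_inv A ** A = X"
  using matrix_inv_props[OF assms] by (metis matrix_mul_assoc matrix_mul_rid)+

lemma matrix_inv_mult:
  fixes A B :: "'k::field ^ 2 ^ 2"
  assumes "invertible A" "invertible B"
  shows "matrix_inv (A ** B) = matrix_inv B ** matrix_inv A"
  by (rule matrix_inv_unique)
    (simp_all add: assms matrix_mul_assoc matrix_inv_cancel matrix_inv_props)

lemma matrix_inv_matrix_inv:
  assumes "invertible (A :: 'k::field ^ 2 ^ 2)"
  shows "matrix_inv (matrix_inv A) = A"
  using matrix_inv_props[OF assms] by (auto intro: matrix_inv_unique)

lemma pgl_act_inj: "pgl_act X p = pgl_act X q \<longleftrightarrow> p = q"
proof -
  obtain A where A: "invertible A" "X = abs_PGL2 A" by (rule PGL2_cases)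
  obtain u where u: "u \<noteq> 0" "p = abs_P1 u" by (rule P1_cases)
  obtain v where v: "v \<noteq> 0" "q = abs_P1 v" by (rule P1_cases)
  show ?thesis using A u v
    by (simp add: pgl_act_abs abs_P1_eq_iff bracket_mult invertible_det_nz)
qed

lemma cross_pgl_act:
  "cross (pgl_act X p) (pgl_act X q) (pgl_act X r) (pgl_act X s) = cross p q r s"
proof -
  obtain A where A: "invertible A" "X = abs_PGL2 A" by (rule PGL2_cases)
  obtain a where a: "a \<noteq> 0" "p = abs_P1 a" by (rule P1_cases)
  obtain b where b: "b \<noteq> 0" "q = abs_P1 b" by (rule P1_cases)
  obtain c where c: "c \<noteq> 0" "r = abs_P1 c" by (rule P1_cases)
  obtain d where d: "d \<noteq> 0" "s = abs_P1 d" by (rule P1_cases)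
  show ?thesis using A a b c d
    by (simp add: pgl_act_abs cross_abs bracket_mult invertible_det_nz)
qed

lemma pgl_act_conj: "pgl_act (pgl_conj X M) (pgl_act X p) = pgl_act X (pgl_act M p)"
proof -
  obtain A where A: "invertible A" "X = abs_PGL2 A" by (rule PGL2_cases)
  obtain B where B: "invertible B" "M = abs_PGL2 B" by (rule PGL2_cases)
  obtain a where a: "a \<noteq> 0" "p = abs_P1 a" by (rule P1_cases)
  have "A ** B ** matrix_inv A ** A = A ** B"
    using matrix_inv_props[OF A(1)] by (metis matrix_mul_assoc matrix_mul_rid)
  then show ?thesis using A B a matrix_inv_props[OF A(1)]
    by (simp add: pgl_act_abs pgl_conj_abs invertible_mult matrix_vector_mul_assoc)
qed

lemma act_act:
  assumes "invertible A" "invertible B"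
  shows "act (abs_PGL2 A) (act (abs_PGL2 B) P) = act (abs_PGL2 (A ** B)) P"
proof -
  have "pgl_act (abs_PGL2 A) (pgl_act (abs_PGL2 B) p) = pgl_act (abs_PGL2 (A ** B)) p" for p
  proof -
    obtain a where a: "a \<noteq> 0" "p = abs_P1 a" by (rule P1_cases)
    then show ?thesis using assms
      by (simp add: pgl_act_abs invertible_mult matrix_vector_mul_assoc)
  qed
  moreover have "pgl_conj (abs_PGL2 A) (pgl_conj (abs_PGL2 B) M) = pgl_conj (abs_PGL2 (A ** B)) M" for M
  proof -
    obtain C where C: "invertible C" "M = abs_PGL2 C" by (rule PGL2_cases)
    then show ?thesis using assms
      by (simp add: pgl_conj_abs invertible_mult matrix_inv_props matrix_inv_mult matrix_mul_assoc)
  qed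
  ultimately show ?thesis by (simp add: act_def)
qed

lemma matrix_inv_mat_1: "matrix_inv (mat 1) = (mat 1 :: 'k::field ^ 2 ^ 2)"
  by (rule matrix_inv_unique) simp_all

lemma invertible_mat_1: "invertible (mat 1 :: 'k::field ^ 2 ^ 2)"
  by (simp add: invertible_det_nz)

lemma act_one: "act (abs_PGL2 (mat 1)) P = P"
proof -
  have "pgl_act (abs_PGL2 (mat 1)) p = p" for p :: "'a P1"
    by (rule P1_cases[of p]) (simp add: pgl_act_abs invertible_mat_1)
  moreover have "pgl_conj (abs_PGL2 (mat 1)) M = M" for M :: "'a PGL2"
    by (rule PGL2_cases[of M]) (simp add: pgl_conj_abs invertible_mat_1 matrix_inv_mat_1)
  ultimately show ?thesis by (simp add: act_def)
qed

lemma mem_mclass: "P \<in> mclass P"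
  unfolding mclass_def using act_one[of P] by (metis (mono_tags, lifting) mem_Collect_eq)

lemma mclass_act: "mclass (act X P) = mclass P"
proof -
  obtain A where A: "invertible A" "X = abs_PGL2 A" by (rule PGL2_cases)
  have "act Y (act X P) \<in> mclass P" for Y
  proof -
    obtain B where B: "invertible B" "Y = abs_PGL2 B" by (rule PGL2_cases)
    with A show ?thesis by (auto simp: act_act mclass_def)
  qed
  moreover have "act Y P \<in> mclass (act X P)" for Y
  proof -
    obtain B where B: "invertible B" "Y = abs_PGL2 B" by (rule PGL2_cases)
    have "B ** matrix_inv A ** A = B"
      using matrix_inv_props[OF A(1)] by (metis matrix_mul_assoc matrix_mul_rid)
    then have "act Y P = act (abs_PGL2 (B ** matrix_inv A)) (act X P)"
      using A B by (simp add: act_act invertible_mult matrix_inv_props)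
    then show ?thesis by (auto simp: mclass_def)
  qed
  ultimately show ?thesis by (auto simp: mclass_def)
qed

lemma cross_ratio_act: "cross_ratio (act X P) i = cross_ratio P i"
  by (simp add: cross_ratio_def act_def cross_pgl_act)

lemma class_cross_ratio_mclass: "class_cross_ratio (mclass P) = cross_ratio P"
proof -
  have "(SOME Q. Q \<in> mclass P) \<in> mclass P" using mem_mclass by (rule someI)
  then obtain X where "(SOME Q. Q \<in> mclass P) = act X P" by (auto simp: mclass_def)
  then show ?thesis by (auto simp: class_cross_ratio_def cross_ratio_act)
qed

lemma monodromy_matrix_act: "monodromy_matrix n (act X P) = monodromy_matrix n P"
  by (simp add: monodromy_matrix_def cross_ratio_act)

lemma act_ngons:
  assumes "P \<in> ngons n" shows "act X P \<in> ngons n"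
  using assms by (auto simp: ngons_def act_def pgl_act_inj pgl_act_conj)

lemma cross_ratio_nonzero:
  assumes "P \<in> ngons n" shows "cross_ratio P i \<noteq> 0"
proof -
  have d: "fst P (i-1) \<noteq> fst P i" "fst P (i-1) \<noteq> fst P (i+1)" "fst P i \<noteq> fst P (i+1)"
    "fst P i \<noteq> fst P (i+2)" "fst P (i+1) \<noteq> fst P (i+2)"
  proof -
    have *: "fst P j \<noteq> fst P (j + 1)" "fst P j \<noteq> fst P (j + 2)" for j
      using assms by (auto simp: ngons_def)
    show "fst P (i-1) \<noteq> fst P i" "fst P (i-1) \<noteq> fst P (i+1)" "fst P i \<noteq> fst P (i+1)"
    "fst P i \<noteq> fst P (i+2)" "fst P (i+1) \<noteq> fst P (i+2)"
      using *[of "i-1"] *[of i] *(1)[of "i+1"] by (simp_all add: add.commute)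
  qed
  obtain a where a: "a \<noteq> 0" "fst P (i-1) = abs_P1 a" by (rule P1_cases)
  obtain b where b: "b \<noteq> 0" "fst P i = abs_P1 b" by (rule P1_cases)
  obtain c where c: "c \<noteq> 0" "fst P (i+1) = abs_P1 c" by (rule P1_cases)
  obtain e where e: "e \<noteq> 0" "fst P (i+2) = abs_P1 e" by (rule P1_cases)
  show ?thesis using d a b c e
    by (simp add: cross_ratio_def cross_abs abs_P1_eq_iff bracket_commute_zero)
qed


section \<open>The trace as a signed sum over cyclically sparse sets\<close>

text \<open>
  The partial products of the monodromy matrix. Their columns are the homogeneous coordinates
  of consecutive vertices of the polygon in normal position.
\<close>

primrec frame :: "(int \<Rightarrow> 'k::field) \<Rightarrow> nat \<Rightarrow> 'k ^ 2 ^ 2" where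
  "frame c 0 = mat 1"
| "frame c (Suc m) = frame c m ** L_matrix (c (int (Suc m)))"

lemma monodromy_matrix_frame: "monodromy_matrix n P = frame (cross_ratio P) n"
proof -
  have snoc: "foldr (\<lambda>i A. L_matrix (c i) ** A) xs B = foldr (\<lambda>i A. L_matrix (c i) ** A) xs (mat 1) ** B"
    for xs :: "int list" and B and c :: "int \<Rightarrow> 'k::field"
    by (induction xs) (simp_all add: matrix_mul_assoc)
  have "foldr (\<lambda>i A. L_matrix (c i) ** A) [1..int n] (mat 1) = frame c n" for c :: "int \<Rightarrow> 'k::field"
  proof (induction n)
    case (Suc n)
    have "[1..int (Suc n)] = [1..int n] @ [int (Suc n)]"
      using upto_rec2[of 1 "int (Suc n)"] by simp
    then have "foldr (\<lambda>i A. L_matrix (c i) ** A) [1..int (Suc n)] (mat 1) =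
        foldr (\<lambda>i A. L_matrix (c i) ** A) [1..int n] (L_matrix (c (int (Suc n))))"
      by simp
    also have "\<dots> = frame c n ** L_matrix (c (int (Suc n)))"
      by (subst snoc) (simp only: Suc)
    finally show ?case by simp
  qed simp
  then show ?thesis by (simp add: monodromy_matrix_def)
qed

definition sparse :: "int \<Rightarrow> int \<Rightarrow> int set set" where
  "sparse a b = {I. I \<subseteq> {a..b} \<and> (\<forall>i\<in>I. i + 1 \<notin> I)}"

definition signed_sum :: "(int \<Rightarrow> 'k::field) \<Rightarrow> int set set \<Rightarrow> 'k" where
  "signed_sum c \<I> = (\<Sum>I\<in>\<I>. (- 1) ^ card I * (\<Prod>i\<in>I. c i))"

lemma finite_sparse: "finite (sparse a b)"
  by (rule finite_subset[of _ "Pow {a..b}"]) (auto simp: sparse_def)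

lemma signed_sum_insert:
  assumes "finite \<I>" "\<And>I. I \<in> \<I> \<Longrightarrow> finite I \<and> j \<notin> I"
  shows "signed_sum c (insert j ` \<I>) = - c j * signed_sum c \<I>"
proof -
  have inj: "inj_on (insert j) \<I>"
    using assms(2) by (metis (no_types, lifting) inj_onI insert_ident)
  show ?thesis
    unfolding signed_sum_def using assms(2)
    by (simp add: sum.reindex[OF inj] sum_distrib_left sum_negf[symmetric] mult_ac del: sum_negf)
qed

lemma signed_sum_Un:
  assumes "finite \<I>" "finite \<J>" "\<I> \<inter> \<J> = {}"
  shows "signed_sum c (\<I> \<union> \<J>) = signed_sum c \<I> + signed_sum c \<J>"
  using assms unfolding signed_sum_def by (rule sum.union_disjoint)

lemma sparse_finite: "I \<in> sparse a b \<Longrightarrow> finite I"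
  by (auto simp: sparse_def intro: finite_subset)

text \<open>
  A sparse set either avoids the last index \<open>b\<close>, or it contains \<open>b\<close> and avoids \<open>b - 1\<close>.
  The result is the recurrence of the entries of the matrices \<open>frame c m\<close>.
\<close>

lemma signed_sum_sparse_rec:
  assumes "a \<le> b"
  shows "signed_sum c (sparse a b) =
    signed_sum c (sparse a (b - 1)) - c b * signed_sum c (sparse a (b - 2))"
proof -
  have "sparse a b = sparse a (b - 1) \<union> insert b ` sparse a (b - 2)" (is "?L = ?R")
  proof (intro set_eqI iffI)
    fix I assume I: "I \<in> ?L"
    show "I \<in> ?R"
    proof (cases "b \<in> I")
      case True
      have "b - 1 \<notin> I" using I True by (force simp: sparse_def)
      have "I - {b} \<in> sparse a (b - 2)"
      proof -
        have "x \<le> b - 2" if "x \<in> I - {b}" for x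
        proof -
          have "x \<noteq> b - 1" "x \<noteq> b" "x \<le> b" using that I \<open>b - 1 \<notin> I\<close> by (auto simp: sparse_def)
          then show ?thesis by linarith
        qed
        then have "I - {b} \<subseteq> {a..b - 2}" using I by (auto simp: sparse_def subset_iff)
        then show ?thesis using I by (auto simp: sparse_def)
      qed
      moreover have "I = insert b (I - {b})" using True by auto
      ultimately show ?thesis by blast
    next
      case False
      then have "x \<le> b - 1" if "x \<in> I" for x using that I
        by (metis (mono_tags, lifting) atLeastAtMost_iff in_mono mem_Collect_eq order_le_less sparse_def zle_diff1_eq)
      then show ?thesis using I by (auto simp: sparse_def)
    qed
  next
    fix I assume "I \<in> ?R"
    then show "I \<in> ?L" using assms by (fastforce simp: sparse_def)
  qed
  moreover have "signed_sum c (insert b ` sparse a (b - 2)) = - c b * signed_sum c (sparse a (b - 2))"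
    by (rule signed_sum_insert) (auto simp: finite_sparse sparse_finite, auto simp: sparse_def)
  moreover have "sparse a (b - 1) \<inter> insert b ` sparse a (b - 2) = {}"
    by (auto simp: sparse_def)
  ultimately show ?thesis by (simp add: signed_sum_Un finite_sparse)
qed

lemma signed_sum_sparse_empty:
  assumes "b < a" shows "signed_sum c (sparse a b) = 1"
proof -
  have "sparse a b = {{}}" using assms by (auto simp: sparse_def)
  then show ?thesis by (simp add: signed_sum_def)
qed

text \<open>
  Right multiplication by \<open>L_matrix\<close> shifts the second column into the first with a sign, so both
  columns are governed by a single second-order recurrence, that of the sparse sums; the two rows
  differ in the initial values. Two factors at least are needed for this form: the sum over sparse
  subsets of \<open>{3..0}\<close> is \<open>1\<close>, whereas the corresponding entry for one factor is \<open>0\<close>.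
\<close>

lemma frame_entries:
  fixes c :: "int \<Rightarrow> 'k::field"
  defines "S a b \<equiv> signed_sum c (sparse a (int b))"
  shows "frame c (Suc (Suc m)) $ 1 $ 1 = - c 1 * S 3 (Suc m)"
    and "frame c (Suc (Suc m)) $ 1 $ 2 = c 1 * S 3 (Suc (Suc m))"
    and "frame c (Suc (Suc m)) $ 2 $ 1 = - S 2 (Suc m)"
    and "frame c (Suc (Suc m)) $ 2 $ 2 = S 2 (Suc (Suc m))"
proof -
  have step: "frame c (Suc j) $ i $ 1 = - (frame c j $ i $ 2)"
    "frame c (Suc j) $ i $ 2 = frame c j $ i $ 1 * c (int (Suc j)) + frame c j $ i $ 2" for j i
    by (simp_all add: matrix_matrix_mult_def sum_2 L_matrix_def)
  have one: "frame c 1 $ 1 $ 1 = 0" "frame c 1 $ 1 $ 2 = c 1" "frame c 1 $ 2 $ 1 = - 1" "frame c 1 $ 2 $ 2 = 1"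
    by (simp_all add: matrix_matrix_mult_def sum_2 L_matrix_def mat_def)
  have "frame c (Suc (Suc m)) $ 1 $ 2 = c 1 * S 3 (Suc (Suc m)) \<and> frame c (Suc m) $ 1 $ 2 = c 1 * S 3 (Suc m) \<and>
     frame c (Suc (Suc m)) $ 2 $ 2 = S 2 (Suc (Suc m)) \<and> frame c (Suc m) $ 2 $ 2 = S 2 (Suc m)"
  proof (induction m)
    case 0
    have "S 2 2 = 1 - c 2"
      unfolding S_def by (simp add: signed_sum_sparse_rec signed_sum_sparse_empty)
    then show ?case using step[of 1] one
      by (simp add: numeral_2_eq_2) (simp add: S_def signed_sum_sparse_empty)
  next
    case (Suc m)
    have "S a (Suc (Suc (Suc m))) = S a (Suc (Suc m)) - c (int (Suc (Suc (Suc m)))) * S a (Suc m)" if "a \<in> {2,3}" for a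
      using signed_sum_sparse_rec[of a "int (Suc (Suc (Suc m)))" c] that
      unfolding S_def by (auto simp: algebra_simps)
    moreover have "frame c (Suc (Suc (Suc m))) $ i $ 2 =
        frame c (Suc (Suc m)) $ i $ 2 - c (int (Suc (Suc (Suc m)))) * frame c (Suc m) $ i $ 2" for i
      unfolding step(2)[of "Suc (Suc m)"] step(1)[of "Suc m"] by (simp add: mult.commute del: frame.simps)
    ultimately show ?case using Suc by (simp add: right_diff_distrib mult.left_commute del: frame.simps of_nat_Suc)
  qed
  then show "frame c (Suc (Suc m)) $ 1 $ 1 = - c 1 * S 3 (Suc m)"
    and "frame c (Suc (Suc m)) $ 1 $ 2 = c 1 * S 3 (Suc (Suc m))"
    and "frame c (Suc (Suc m)) $ 2 $ 1 = - S 2 (Suc m)"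
    and "frame c (Suc (Suc m)) $ 2 $ 2 = S 2 (Suc (Suc m))"
    using step(1)[of "Suc m"] by (simp_all del: frame.simps)
qed

text \<open>
  For a single index, the condition modulo \<open>n\<close> makes \<open>1\<close> its own neighbour, which is why
  this description starts at \<open>n = 2\<close>.
\<close>

lemma cyclically_sparse_iff:
  assumes "n \<ge> 2"
  shows "cyclically_sparse n I \<longleftrightarrow>
    I \<subseteq> {1..int n} \<and> (\<forall>i\<in>I. i + 1 \<notin> I) \<and> \<not> (1 \<in> I \<and> int n \<in> I)"
proof -
  have "j mod int n = (i + 1) mod int n \<longleftrightarrow> j = i + 1 \<or> (i = int n \<and> j = 1)"
    if "i \<in> {1..int n}" "j \<in> {1..int n}" for i j
  proof -
    have 1: "j mod int n = (if j = int n then 0 else j)" using that by auto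
    have 2: "(i + 1) mod int n = (if i = int n then 1 else if i + 1 = int n then 0 else i + 1)"
    proof (cases "i = int n")
      case True then show ?thesis using assms by simp
    next
      case False then show ?thesis using that by auto
    qed
    show ?thesis unfolding 1 2 using that assms by auto
  qed
  then show ?thesis unfolding cyclically_sparse_def by (metis subsetD)
qed

text \<open>
  A cyclically sparse set that avoids \<open>1\<close> is a sparse subset of \<open>{2..n}\<close>; one that contains \<open>1\<close>
  avoids its neighbours \<open>2\<close> and \<open>n\<close> and leaves a sparse subset of \<open>{3..n - 1}\<close>. The two families
  give the two diagonal entries of the product.
\<close>

lemma trace_frame:
  assumes "n \<ge> 1"
  shows "trace (frame c n) = signed_sum c {I. cyclically_sparse n I}"
proof (cases "n = 1")
  case True
  have "{I. cyclically_sparse n I} = {{}}"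
    using True by (auto simp: cyclically_sparse_def)
  then show ?thesis using True
    by (simp add: signed_sum_def trace_def sum_2 matrix_matrix_mult_def L_matrix_def mat_def)
next
  case False
  then obtain m where m: "n = Suc (Suc m)" using assms by (metis One_nat_def Suc_le_D le_antisym not_less_eq_eq)
  have "{I. cyclically_sparse n I} = sparse 2 (int n) \<union> insert 1 ` sparse 3 (int n - 1)" (is "?L = ?R")
  proof (intro set_eqI iffI)
    fix I assume "I \<in> ?L"
    then have I: "I \<subseteq> {1..int n}" "\<forall>i\<in>I. i + 1 \<notin> I" "\<not> (1 \<in> I \<and> int n \<in> I)"
      using m by (auto simp: cyclically_sparse_iff)
    show "I \<in> ?R"
    proof (cases "1 \<in> I")
      case True
      have "x \<in> {3..int n - 1}" if "x \<in> I - {1}" for x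
      proof -
        have "2 \<notin> I" using I(2) True by force
        then have "x \<noteq> 1" "x \<noteq> 2" "x \<noteq> int n" "1 \<le> x" "x \<le> int n" using that I True by auto
        then show ?thesis by auto
      qed
      then have "I - {1} \<subseteq> {3..int n - 1}" by blast
      then have "I - {1} \<in> sparse 3 (int n - 1)" using I(2) by (auto simp: sparse_def)
      moreover have "I = insert 1 (I - {1})" using True by auto
      ultimately show ?thesis by blast
    next
      case False
      have "x \<in> {2..int n}" if "x \<in> I" for x
      proof -
        have "x \<noteq> 1" "1 \<le> x" "x \<le> int n" using that I False by auto
        then show ?thesis by auto
      qed
      then show ?thesis using I(2) by (auto simp: sparse_def)
    qed
  next
    fix I assume "I \<in> ?R"
    then show "I \<in> ?L" using m by (fastforce simp: sparse_def cyclically_sparse_iff)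
  qed
  moreover have "signed_sum c (insert 1 ` sparse 3 (int n - 1)) = - c 1 * signed_sum c (sparse 3 (int n - 1))"
    by (rule signed_sum_insert) (auto simp: finite_sparse sparse_finite, auto simp: sparse_def)
  moreover have "sparse 2 (int n) \<inter> insert 1 ` sparse 3 (int n - 1) = {}"
    by (auto simp: sparse_def)
  ultimately have "signed_sum c {I. cyclically_sparse n I} =
      signed_sum c (sparse 2 (int n)) - c 1 * signed_sum c (sparse 3 (int n - 1))"
    by (simp add: signed_sum_Un finite_sparse)
  then show ?thesis
    using m by (simp add: trace_def sum_2 frame_entries del: frame.simps)
qed

lemma finite_cyclically_sparse: "finite {I. cyclically_sparse n I}"
  by (rule finite_subset[of _ "Pow {1..int n}"]) (auto simp: cyclically_sparse_def)

text \<open>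
  The cyclic shift of a cyclically sparse set is disjoint from it and has the same cardinality.
\<close>

lemma card_cyclically_sparse:
  assumes "cyclically_sparse n I"
  shows "finite I" "card I \<le> n div 2"
proof -
  have I: "I \<subseteq> {1..int n}" using assms by (auto simp: cyclically_sparse_def)
  then show fin: "finite I" by (rule finite_subset) simp
  \<comment> \<open>The cyclic successor on \<open>{1..n}\<close>.\<close>
  define s where "s i = i mod int n + 1" for i :: int
  have "inj_on s I"
  proof
    fix x y assume "x \<in> I" "y \<in> I" "s x = s y"
    then have xy: "x \<in> {1..int n}" "y \<in> {1..int n}" "x mod int n = y mod int n"
      using I by (auto simp: s_def)
    have "z mod int n = (if z = int n then 0 else z)" if "z \<in> {1..int n}" for z
      using that by auto
    then show "x = y" using xy by (auto split: if_splits)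
  qed
  moreover have "s ` I \<inter> I = {}"
  proof -
    have "s i \<notin> I" if "i \<in> I" for i
    proof
      assume "s i \<in> I"
      moreover have "s i mod int n = (i + 1) mod int n" by (simp add: s_def mod_simps)
      ultimately show False using assms that unfolding cyclically_sparse_def by blast
    qed
    then show ?thesis by auto
  qed
  moreover have "s ` I \<subseteq> {1..int n}"
  proof
    fix y assume "y \<in> s ` I"
    then obtain i where i: "i \<in> I" "y = s i" by auto
    then have "int n > 0" using I by force
    then show "y \<in> {1..int n}" using i
      by (auto simp: s_def) (simp add: add1_zle_eq)
  qed
  ultimately have "card I + card I \<le> card {1..int n}"
    using I fin by (metis Int_commute Un_least card_Un_disjoint card_image card_mono
        finite_atLeastAtMost_int finite_imageI)
  then show "card I \<le> n div 2" by simp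
qed

text \<open>
  Each product over \<open>I\<close> is expanded by choosing the set \<open>J\<close> of factors that contribute their
  linear term; the terms are then collected by \<open>card J\<close>. No exponent exceeds \<open>n div 2\<close> because no
  cyclically sparse set is larger.
\<close>

lemma signed_sum_expansion:
  fixes a b :: "int \<Rightarrow> 'k::field"
  assumes "\<And>i. a i \<noteq> 0"
  shows "signed_sum (\<lambda>i. a i + b i * s) {I. cyclically_sparse n I} =
    (\<Sum>k = 0..n div 2. (\<Sum>I\<in>{I. cyclically_sparse n I \<and> k \<le> card I}.
        (- 1) ^ card I * (\<Prod>i\<in>I. a i) *
        (\<Sum>J\<in>{J. J \<subseteq> I \<and> card J = k}. (\<Prod>i\<in>J. b i) / (\<Prod>i\<in>J. a i))) * s ^ k)"
proof -
  define f where "f I k = (- 1) ^ card I * (\<Prod>i\<in>I. a i) *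
        (\<Sum>J\<in>{J. J \<subseteq> I \<and> card J = k}. (\<Prod>i\<in>J. b i) / (\<Prod>i\<in>J. a i))" for I k
  have expand: "(- 1) ^ card I * (\<Prod>i\<in>I. a i + b i * s) = (\<Sum>k = 0..n div 2. f I k * s ^ k)"
    if I: "cyclically_sparse n I" for I
  proof -
    note fin = card_cyclically_sparse[OF I]
    have "(\<Prod>i\<in>I. a i + b i * s) = (\<Prod>i\<in>I. b i * s + a i)" by (simp add: add.commute)
    also have "\<dots> = (\<Sum>J\<in>Pow I. (\<Prod>i\<in>J. b i * s) * (\<Prod>i\<in>I - J. a i))"
      by (rule prod_add[OF fin(1)])
    also have "\<dots> = (\<Sum>J\<in>Pow I. (\<Prod>i\<in>I. a i) * ((\<Prod>i\<in>J. b i) / (\<Prod>i\<in>J. a i)) * s ^ card J)"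
    proof (rule sum.cong[OF refl])
      fix J assume "J \<in> Pow I"
      then have "(\<Prod>i\<in>I. a i) = (\<Prod>i\<in>I - J. a i) * (\<Prod>i\<in>J. a i)"
        using fin(1) by (intro prod.subset_diff) auto
      moreover have "(\<Prod>i\<in>J. a i) \<noteq> 0" using assms
        by (metis prod_zero_iff prod.infinite one_neq_zero)
      ultimately show "(\<Prod>i\<in>J. b i * s) * (\<Prod>i\<in>I - J. a i) =
          (\<Prod>i\<in>I. a i) * ((\<Prod>i\<in>J. b i) / (\<Prod>i\<in>J. a i)) * s ^ card J"
        by (simp add: prod.distrib mult_ac)
    qed
    also have "\<dots> = (\<Sum>k = 0..n div 2. \<Sum>J\<in>{J \<in> Pow I. card J = k}.
        (\<Prod>i\<in>I. a i) * ((\<Prod>i\<in>J. b i) / (\<Prod>i\<in>J. a i)) * s ^ card J)"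
    proof (rule sum.group[symmetric])
      show "card ` Pow I \<subseteq> {0..n div 2}"
        using fin by (auto intro: order_trans[OF card_mono])
    qed (use fin in auto)
    also have "\<dots> = (\<Sum>k = 0..n div 2. (\<Prod>i\<in>I. a i) *
        (\<Sum>J\<in>{J. J \<subseteq> I \<and> card J = k}. (\<Prod>i\<in>J. b i) / (\<Prod>i\<in>J. a i)) * s ^ k)"
      by (simp add: sum_distrib_left sum_distrib_right)
    finally show ?thesis by (simp add: f_def sum_distrib_left mult_ac)
  qed
  \<comment> \<open>Sets with fewer than \<open>k\<close> elements have no \<open>J\<close> to sum over, which allows the bound on \<open>card I\<close>.\<close>
  have vanish: "f I k = 0" if I: "cyclically_sparse n I" "\<not> k \<le> card I" for I k
  proof -
    have "{J. J \<subseteq> I \<and> card J = k} = {}"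
      using I(2) card_cyclically_sparse(1)[OF I(1)] card_mono by blast
    then show ?thesis unfolding f_def by (simp only: sum.empty mult_zero_right)
  qed
  have "signed_sum (\<lambda>i. a i + b i * s) {I. cyclically_sparse n I} =
      (\<Sum>I\<in>{I. cyclically_sparse n I}. \<Sum>k = 0..n div 2. f I k * s ^ k)"
    unfolding signed_sum_def by (rule sum.cong) (auto simp: expand)
  also have "\<dots> = (\<Sum>k = 0..n div 2. (\<Sum>I\<in>{I. cyclically_sparse n I}. f I k) * s ^ k)"
    by (subst sum.swap) (simp add: sum_distrib_right)
  also have "\<dots> = (\<Sum>k = 0..n div 2. (\<Sum>I\<in>{I. cyclically_sparse n I \<and> k \<le> card I}. f I k) * s ^ k)"
  proof -
    have "(\<Sum>I\<in>{I. cyclically_sparse n I}. f I k) =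
        (\<Sum>I\<in>{I. cyclically_sparse n I \<and> k \<le> card I}. f I k)" for k
      by (rule sum.mono_neutral_right) (auto simp: finite_cyclically_sparse vanish)
    then show ?thesis by simp
  qed
  finally show ?thesis by (simp add: f_def)
qed


section \<open>The normal form of a polygon\<close>

text \<open>
  Representatives of the points \<open>1\<close>, \<open>\<infinity>\<close> and \<open>0\<close>.
\<close>

abbreviation e0 :: "'k::field ^ 2" where "e0 \<equiv> vector [1, 1]"
abbreviation e1 :: "'k::field ^ 2" where "e1 \<equiv> vector [1, 0]"
abbreviation e2 :: "'k::field ^ 2" where "e2 \<equiv> vector [0, 1]"

lemma base_points_nonzero: "e0 \<noteq> (0 :: 'k::field ^ 2)" "e1 \<noteq> (0 :: 'k ^ 2)" "e2 \<noteq> (0 :: 'k ^ 2)"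
  "vector [a, 1] \<noteq> (0 :: 'k ^ 2)"
  by (simp_all add: vec_eq_iff forall_2)

text \<open>
  The rows of the matrix are the linear forms \<open>bracket _ c\<close> and \<open>bracket _ b\<close>, which vanish at \<open>r\<close>
  and \<open>q\<close>; the two factors scale them so that both take the same value at \<open>p\<close>.
\<close>

lemma send_to_base_points:
  fixes p q r :: "'k::field P1"
  assumes "p \<noteq> q" "q \<noteq> r" "p \<noteq> r"
  obtains B where "invertible B" "pgl_act (abs_PGL2 B) p = abs_P1 e0"
    "pgl_act (abs_PGL2 B) q = abs_P1 e1" "pgl_act (abs_PGL2 B) r = abs_P1 e2"
proof -
  obtain a where a: "a \<noteq> 0" "p = abs_P1 a" by (rule P1_cases)
  obtain b where b: "b \<noteq> 0" "q = abs_P1 b" by (rule P1_cases)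
  obtain c where c: "c \<noteq> 0" "r = abs_P1 c" by (rule P1_cases)
  have nz: "bracket a b \<noteq> 0" "bracket b c \<noteq> 0" "bracket a c \<noteq> 0" "bracket c b \<noteq> 0"
    using assms a b c by (simp_all add: abs_P1_eq_iff bracket_commute_zero[of b c])
  define B :: "'k ^ 2 ^ 2" where
    "B = vector [bracket a b *s vector [c $ 2, - (c $ 1)], bracket a c *s vector [b $ 2, - (b $ 1)]]"
  have B: "B *v x = vector [bracket a b * bracket x c, bracket a c * bracket x b]" for x
    by (simp add: B_def matrix_vector_mult_def vec_eq_iff forall_2 sum_2 bracket_def algebra_simps)
  have "det B * bracket b c \<noteq> 0"
    unfolding bracket_mult[symmetric] B using nz by (simp add: bracket_def)
  then have inv: "invertible B" by (simp add: invertible_det_nz)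
  show ?thesis
  proof (rule that[OF inv])
    have "B *v a \<noteq> 0" "B *v b \<noteq> 0" "B *v c \<noteq> 0"
      using a b c inv by (simp_all add: pgl_act_abs)
    moreover have "bracket (B *v a) e0 = 0" "bracket (B *v b) e1 = 0" "bracket (B *v c) e2 = 0"
      unfolding B by (simp_all add: bracket_def)
    ultimately show "pgl_act (abs_PGL2 B) p = abs_P1 e0"
        "pgl_act (abs_PGL2 B) q = abs_P1 e1" "pgl_act (abs_PGL2 B) r = abs_P1 e2"
      using a b c inv by (simp_all add: pgl_act_abs abs_P1_eq_iff base_points_nonzero)
  qed
qed

text \<open>
  The group \<open>PGL\<^sub>2\<close> acts freely on triples of distinct points: a matrix that fixes
  \<open>\<infinity>\<close> and \<open>0\<close> is diagonal, and fixing \<open>1\<close> as well makes it scalar.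
\<close>

lemma abs_PGL2_eqI:
  fixes A B :: "'k::field ^ 2 ^ 2"
  assumes "invertible A" "invertible B"
    and "\<And>v. v \<in> {e0, e1, e2} \<Longrightarrow> abs_P1 (A *v v) = abs_P1 (B *v v)"
  shows "abs_PGL2 A = abs_PGL2 B"
proof -
  define C where "C = matrix_inv A ** B"
  have BAC: "B = A ** C"
    using matrix_inv_props[OF assms(1)] by (simp add: C_def matrix_mul_assoc)
  have C: "bracket v (C *v v) = 0" if "v \<in> {e0, e1, e2}" for v
  proof -
    have "v \<noteq> 0" using that base_points_nonzero by auto
    then have "A *v v \<noteq> 0" "B *v v \<noteq> 0" using assms invertible_mult_eq_0 by blast+
    with assms(3)[OF that] have "bracket (A *v v) (B *v v) = 0" by (simp add: abs_P1_eq_iff)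
    then have "det A * bracket v (C *v v) = 0"
      unfolding BAC by (simp add: bracket_mult flip: matrix_vector_mul_assoc)
    then show ?thesis using assms(1) by (simp add: invertible_det_nz)
  qed
  have "C $ 2 $ 1 = 0" "C $ 1 $ 2 = 0" "C $ 1 $ 1 = C $ 2 $ 2"
    using C[of e0] C[of e1] C[of e2] by (simp_all add: bracket_def matrix_vector_mult_def sum_2)
  then have "C = smat (C $ 1 $ 1) (mat 1)"
    by (simp add: smat_def mat_def vec_eq_iff forall_2)
  then have B: "B = smat (C $ 1 $ 1) A"
    unfolding BAC by (metis smat_mult(2) matrix_mul_rid)
  moreover have "C $ 1 $ 1 \<noteq> 0"
  proof
    assume "C $ 1 $ 1 = 0"
    then have "det B = 0" using B by (simp add: det_2 smat_def)
    with assms(2) show False by (simp add: invertible_det_nz)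
  qed
  ultimately show ?thesis using abs_PGL2_smat[OF assms(1)] by metis
qed

text \<open>
  Three vertices and a cross-ratio determine the next vertex. This is the three-term
  Pluecker relation between the brackets of four vectors in the plane.
\<close>

lemma cross_cancel_right:
  assumes "p \<noteq> q" "q \<noteq> r" "p \<noteq> r" "x \<noteq> q" "y \<noteq> q"
    and "cross p q r x = cross p q r y"
  shows "x = y"
proof -
  obtain a where a: "a \<noteq> 0" "p = abs_P1 a" by (rule P1_cases)
  obtain b where b: "b \<noteq> 0" "q = abs_P1 b" by (rule P1_cases)
  obtain c where c: "c \<noteq> 0" "r = abs_P1 c" by (rule P1_cases)
  obtain d where d: "d \<noteq> 0" "x = abs_P1 d" by (rule P1_cases)
  obtain e where e: "e \<noteq> 0" "y = abs_P1 e" by (rule P1_cases)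
  have nz: "bracket b a \<noteq> 0" "bracket b c \<noteq> 0" "bracket c a \<noteq> 0" "bracket b d \<noteq> 0" "bracket b e \<noteq> 0"
    using assms(1-5) a b c d e by (simp_all add: abs_P1_eq_iff bracket_commute_zero)
  have "bracket c d * bracket b e = bracket c e * bracket b d"
    using assms(6) a b c d e nz by (simp add: cross_abs field_simps)
  moreover have "bracket c d * bracket b e - bracket c e * bracket b d = - bracket b c * bracket d e"
    by (simp add: bracket_def algebra_simps)
  ultimately have "bracket d e = 0" using nz by simp
  then show ?thesis using d e by (simp add: abs_P1_eq_iff)
qed

lemma invertible_frame:
  assumes "\<And>i. c i \<noteq> 0" shows "invertible (frame c m)"
proof (induction m)
  case (Suc m)
  have "det (L_matrix (c (int (Suc m)))) = c (int (Suc m))"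
    by (simp add: L_matrix_def det_2)
  then show ?case using Suc assms by (simp add: invertible_det_nz det_mul del: of_nat_Suc)
qed (simp add: invertible_mat_1)

text \<open>
  The matrix \<open>frame c m\<close> carries \<open>1\<close>, \<open>\<infinity>\<close>, \<open>0\<close> to the vertices number \<open>m\<close>, \<open>m + 1\<close> and \<open>m + 2\<close>. In the
  induction step \<open>L_matrix c\<close> carries \<open>1\<close> to \<open>\<infinity>\<close> and \<open>\<infinity>\<close> to \<open>0\<close>, and \<open>0\<close> to the point \<open>c\<close>, which is the
  one with cross-ratio \<open>c\<close> relative to \<open>1\<close>, \<open>\<infinity>\<close>, \<open>0\<close>.
\<close>

lemma normal_form_vertices:
  fixes P :: "'k::field ngon"
  defines "c \<equiv> cross_ratio P"
  assumes P: "P \<in> ngons n"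
    and B: "invertible B" "pgl_act (abs_PGL2 B) (fst P 0) = abs_P1 e0"
    "pgl_act (abs_PGL2 B) (fst P 1) = abs_P1 e1" "pgl_act (abs_PGL2 B) (fst P 2) = abs_P1 e2"
  shows "pgl_act (abs_PGL2 B) (fst P (int m)) = abs_P1 (frame c m *v e0) \<and>
    pgl_act (abs_PGL2 B) (fst P (int m + 1)) = abs_P1 (frame c m *v e1) \<and>
    pgl_act (abs_PGL2 B) (fst P (int m + 2)) = abs_P1 (frame c m *v e2)"
proof (induction m)
  case 0
  show ?case using B by simp
next
  case (Suc m)
  let ?p = "\<lambda>i. pgl_act (abs_PGL2 B) (fst P i)"
  let ?G = "frame c m" and ?c = "c (int (Suc m))"
  have dist: "?p i \<noteq> ?p (i + 1)" "?p (i + 1) \<noteq> ?p (i + 2)" "?p i \<noteq> ?p (i + 2)" for i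
    using P by (auto simp: ngons_def pgl_act_inj)
  have c: "c i \<noteq> 0" for i using cross_ratio_nonzero[OF P] by (simp add: c_def)
  have G: "invertible ?G" using c by (rule invertible_frame)
  have nz: "?G *v v \<noteq> 0" if "v \<noteq> 0" for v using G that invertible_mult_eq_0 by blast
  have scale: "abs_P1 (k *s v) = abs_P1 v" if "k \<noteq> 0" "v \<noteq> 0" for k and v :: "'k ^ 2"
    using that by (simp add: abs_P1_eq_iff) (simp add: bracket_def)
  have L: "L_matrix ?c *v e0 = ?c *s e1" "L_matrix ?c *v e1 = (- 1) *s e2"
    "L_matrix ?c *v e2 = vector [?c, 1]"
    by (simp_all add: L_matrix_def matrix_vector_mult_def vec_eq_iff forall_2 sum_2)
  have F: "frame c (Suc m) *v v = ?G *v (L_matrix ?c *v v)" for v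
    by (simp add: matrix_vector_mul_assoc)
  have "?p (int m + 3) = abs_P1 (?G *v vector [?c, 1])"
  proof (rule cross_cancel_right)
    show "?p (int m) \<noteq> ?p (int m + 1)" "?p (int m + 1) \<noteq> ?p (int m + 2)"
      "?p (int m) \<noteq> ?p (int m + 2)"
      using dist[of "int m"] by auto
    show "?p (int m + 3) \<noteq> ?p (int m + 1)"
      using dist(3)[of "int m + 1"] by (simp add: add.commute eq_commute)
    show "abs_P1 (?G *v vector [?c, 1]) \<noteq> ?p (int m + 1)"
      using Suc G by (simp add: abs_P1_eq_iff nz base_points_nonzero bracket_mult invertible_det_nz)
        (simp add: bracket_def)
    have "cross (?p (int m)) (?p (int m + 1)) (?p (int m + 2)) (?p (int m + 3)) = ?c"
      by (simp add: cross_pgl_act c_def cross_ratio_def add.commute)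
    moreover have "cross (?p (int m)) (?p (int m + 1)) (?p (int m + 2)) (abs_P1 (?G *v vector [?c, 1])) = ?c"
      using Suc G by (simp add: cross_abs nz base_points_nonzero bracket_mult invertible_det_nz)
        (simp add: bracket_def)
    ultimately show "cross (?p (int m)) (?p (int m + 1)) (?p (int m + 2)) (?p (int m + 3)) =
        cross (?p (int m)) (?p (int m + 1)) (?p (int m + 2)) (abs_P1 (?G *v vector [?c, 1]))"
      by simp
  qed
  moreover have "abs_P1 (frame c (Suc m) *v e0) = abs_P1 (?G *v e1)"
    unfolding F L using c by (simp add: scale nz base_points_nonzero vector_scalar_commute del: of_nat_Suc)
  moreover have "abs_P1 (frame c (Suc m) *v e1) = abs_P1 (?G *v e2)"
    unfolding F L vector_scalar_commute by (rule scale) (simp_all add: nz base_points_nonzero)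
  moreover have "frame c (Suc m) *v e2 = ?G *v vector [?c, 1]"
    unfolding F L ..
  moreover have "int (Suc m) = int m + 1" "int m + 1 + 1 = int m + 2" "int m + 1 + 2 = int m + 3"
    by simp_all
  ultimately show ?case using Suc by (simp add: ac_simps del: frame.simps)
qed

text \<open>
  In the position where the first three vertices are \<open>1\<close>, \<open>\<infinity>\<close>, \<open>0\<close>, a polygon has homogeneous
  coordinates that are polynomials in its cross-ratios. The monodromy carries the first three
  vertices to the vertices number \<open>n\<close>, \<open>n + 1\<close>, \<open>n + 2\<close>, and so does \<open>frame c n\<close>; hence they agree.
\<close>

lemma normal_form:
  fixes P :: "'k::field ngon"
  assumes P: "P \<in> ngons n"
  obtains B where "invertible B"
    "\<And>m. pgl_act (abs_PGL2 B) (fst P (int m)) = abs_P1 (frame (cross_ratio P) m *v e0)"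
    "pgl_conj (abs_PGL2 B) (snd P) = abs_PGL2 (frame (cross_ratio P) n)"
proof -
  let ?c = "cross_ratio P"
  have "fst P 0 \<noteq> fst P (0 + 1) \<and> fst P (0 + 1) \<noteq> fst P (0 + 2) \<and> fst P 0 \<noteq> fst P (0 + 2)"
    using P unfolding ngons_def by (metis (mono_tags, lifting) case_prodE fst_conv mem_Collect_eq)
  then obtain B where B: "invertible B" "pgl_act (abs_PGL2 B) (fst P 0) = abs_P1 e0"
    "pgl_act (abs_PGL2 B) (fst P 1) = abs_P1 e1" "pgl_act (abs_PGL2 B) (fst P 2) = abs_P1 e2"
    using send_to_base_points[of "fst P 0" "fst P 1" "fst P 2"] by auto
  note v = normal_form_vertices[OF P B]
  have "invertible (frame ?c n)" using cross_ratio_nonzero[OF P] by (rule invertible_frame)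
  obtain C where C: "invertible C" "pgl_conj (abs_PGL2 B) (snd P) = abs_PGL2 C" by (rule PGL2_cases)
  have "abs_P1 (C *v v) = abs_P1 (frame ?c n *v v)"
    if i: "pgl_act (abs_PGL2 B) (fst P i) = abs_P1 v" "v \<noteq> 0"
      "pgl_act (abs_PGL2 B) (fst P (int n + i)) = abs_P1 (frame ?c n *v v)" for v i
  proof -
    have "fst P (i + int n) = pgl_act (snd P) (fst P i)" using P by (auto simp: ngons_def)
    with i(3) have "pgl_act (pgl_conj (abs_PGL2 B) (snd P)) (pgl_act (abs_PGL2 B) (fst P i)) =
        abs_P1 (frame ?c n *v v)"
      by (simp add: pgl_act_conj add.commute)
    then show ?thesis using i C by (simp add: pgl_act_abs)
  qed
  from this[of 0 e0] this[of 1 e1] this[of 2 e2] have "abs_PGL2 C = abs_PGL2 (frame ?c n)"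
    using B v[of n] C \<open>invertible (frame ?c n)\<close> base_points_nonzero
    by (intro abs_PGL2_eqI) auto
  then show ?thesis using that[OF B(1)] v C by metis
qed


section \<open>Polynomial functions of the deformation parameter\<close>

definition poly_fun :: "('k::field \<Rightarrow> 'k) \<Rightarrow> bool" where
  "poly_fun g \<longleftrightarrow> (\<exists>p. \<forall>t. g t = poly p t)"

lemma poly_fun_intros:
  "poly_fun (\<lambda>t. a)"
  "poly_fun (\<lambda>t. t)"
  "poly_fun f \<Longrightarrow> poly_fun g \<Longrightarrow> poly_fun (\<lambda>t. f t + g t)"
  "poly_fun f \<Longrightarrow> poly_fun g \<Longrightarrow> poly_fun (\<lambda>t. f t - g t)"
  "poly_fun f \<Longrightarrow> poly_fun g \<Longrightarrow> poly_fun (\<lambda>t. f t * g t)"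
  "poly_fun f \<Longrightarrow> poly_fun (\<lambda>t. - f t)"
proof -
  show "poly_fun (\<lambda>t. a)"
    unfolding poly_fun_def by (rule exI[of _ "[:a:]"]) simp
  show "poly_fun (\<lambda>t. t)"
    unfolding poly_fun_def by (rule exI[of _ "[:0, 1:]"]) simp
  show "poly_fun f \<Longrightarrow> poly_fun (\<lambda>t. - f t)"
    unfolding poly_fun_def by (metis poly_minus)
  assume "poly_fun f" "poly_fun g"
  then show "poly_fun (\<lambda>t. f t + g t)" "poly_fun (\<lambda>t. f t - g t)"
      "poly_fun (\<lambda>t. f t * g t)"
    unfolding poly_fun_def by (metis poly_add, metis poly_diff, metis poly_mult)
qed

text \<open>
  This is how openness in the Zariski topology is used: a polynomial condition \<open>g t \<noteq> 0\<close> that holds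
  for one parameter holds for all but finitely many.
\<close>

lemma finite_zeros:
  assumes "poly_fun g" "g s \<noteq> 0"
  shows "finite {t. g t = 0}"
proof -
  obtain p where p: "\<And>t. g t = poly p t" using assms(1) unfolding poly_fun_def by blast
  then have "p \<noteq> 0" using assms(2) by auto
  then show ?thesis using poly_roots_finite[of p] p by simp
qed

lemma poly_fun_of_polyfuns:
  assumes "h \<in> polyfuns \<iota> X" "\<And>g. g \<in> X \<Longrightarrow> poly_fun (\<lambda>t. g (x t))"
  shows "poly_fun (\<lambda>t. h (x t))"
  using assms(1) by induction (auto intro: poly_fun_intros assms(2))

lemma poly_fun_frame:
  assumes "\<And>i. poly_fun (\<lambda>t. c t i)"
  shows "poly_fun (\<lambda>t. frame (c t) m $ i $ j)"
proof -
  have "\<forall>i j. poly_fun (\<lambda>t. frame (c t) m $ i $ j)"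
  proof (induction m)
    case (Suc m)
    then show ?case using assms
      by (auto simp: matrix_matrix_mult_def sum_2 L_matrix_def forall_2
        intro!: poly_fun_intros simp del: of_nat_Suc)
  qed (auto intro: poly_fun_intros)
  then show ?thesis by blast
qed


section \<open>Openness of the domain along a deformation\<close>

text \<open>
  The vectors with \<open>unroll n x (i + n) = N *v unroll n x i\<close> that extend the coordinates of the first
  \<open>n\<close> vertices. For \<open>i \<ge> 0\<close> no inverse occurs, so these are polynomials in the coordinates;
  the vertices with negative index need \<open>N\<close> to be invertible.
\<close>

definition unroll :: "nat \<Rightarrow> 'k::field hcoords \<Rightarrow> int \<Rightarrow> 'k ^ 2" where
  "unroll n x i =
    (if i div int n \<ge> 0 then ((*v) (snd x) ^^ nat (i div int n)) (fst x (i mod int n))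
     else ((*v) (matrix_inv (snd x)) ^^ nat (- (i div int n))) (fst x (i mod int n)))"

lemma unroll_base: "i \<in> {0..<int n} \<Longrightarrow> unroll n x i = fst x i"
  by (simp add: unroll_def)

lemma unroll_shift:
  assumes "n \<ge> 1" "invertible (snd x)"
  shows "unroll n x (i + int n) = snd x *v unroll n x i"
proof -
  define k where "k = i div int n"
  have k: "(i + int n) div int n = k + 1" "(i + int n) mod int n = i mod int n"
    using assms(1) by (simp_all add: k_def)
  have *: "unroll n x i = (if k \<ge> 0 then ((*v) (snd x) ^^ nat k) (fst x (i mod int n))
     else ((*v) (matrix_inv (snd x)) ^^ nat (- k)) (fst x (i mod int n)))"
    "unroll n x (i + int n) = (if k + 1 \<ge> 0 then ((*v) (snd x) ^^ nat (k + 1)) (fst x (i mod int n))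
     else ((*v) (matrix_inv (snd x)) ^^ nat (- (k + 1))) (fst x (i mod int n)))"
    unfolding unroll_def k by (simp_all add: k_def)
  have inv: "snd x *v (matrix_inv (snd x) *v v) = v" for v
    using matrix_inv_props[OF assms(2)] by (simp add: matrix_vector_mul_assoc)
  consider "k \<ge> 0" | "k = - 1" | "k < - 1" by linarith
  then show ?thesis
  proof cases
    case 1
    then have "nat (k + 1) = Suc (nat k)" by simp
    then show ?thesis using 1 unfolding * by simp
  next
    case 2
    then show ?thesis unfolding * by (simp add: inv)
  next
    case 3
    then have "nat (- k) = Suc (nat (- (k + 1)))" by simp
    then show ?thesis using 3 unfolding * by (simp add: inv)
  qed
qed

lemma poly_fun_unroll:
  assumes n: "n \<ge> 1" and i: "i \<ge> 0"
    and x: "\<And>h. h \<in> hcoord_funs n \<Longrightarrow> poly_fun (\<lambda>t. h (x t))"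
  shows "poly_fun (\<lambda>t. unroll n (x t) i $ j)"
proof -
  have N: "poly_fun (\<lambda>t. snd (x t) $ a $ b)" for a b
  proof -
    have "(\<lambda>(v, N). N $ a $ b) \<in> hcoord_funs n" by (auto simp: hcoord_funs_def)
    from x[OF this] show ?thesis by (simp add: case_prod_unfold)
  qed
  have v: "poly_fun (\<lambda>t. fst (x t) l $ a)" if "l \<in> {0..<int n}" for l a
  proof -
    have "(\<lambda>(v, N). v l $ a) \<in> hcoord_funs n" using that by (force simp: hcoord_funs_def)
    from x[OF this] show ?thesis by (simp add: case_prod_unfold)
  qed
  have "poly_fun (\<lambda>t. (((*v) (snd (x t)) ^^ m) (fst (x t) l)) $ a)"
    if l: "l \<in> {0..<int n}" for m l a
  proof (induction m arbitrary: a)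
    case (Suc m)
    then show ?case
      by (auto simp: matrix_vector_mult_def sum_2 intro!: poly_fun_intros N)
  qed (use v[OF l] in simp)
  moreover have "i mod int n \<in> {0..<int n}" "i div int n \<ge> 0"
    using n i by (simp_all add: pos_imp_zdiv_nonneg_iff)
  ultimately show ?thesis by (simp add: unroll_def)
qed

definition nondegenerate :: "nat \<Rightarrow> 'k::field hcoords \<Rightarrow> bool" where
  "nondegenerate n x \<longleftrightarrow> det (snd x) \<noteq> 0 \<and>
    (\<forall>i\<in>{0..<int n}. \<forall>d\<in>{1, 2}. bracket (unroll n x i) (unroll n x (i + d)) \<noteq> 0)"

lemma periodic_mod:
  fixes n :: nat
  assumes "\<And>i. Q (i + int n) \<longleftrightarrow> Q i"
  shows "Q i \<longleftrightarrow> Q (i mod int n)"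
proof -
  have "Q (j + int n * k) \<longleftrightarrow> Q j" for j k
  proof (induction k rule: int_induct[where k = 0])
    case (step1 k)
    then show ?case using assms[of "j + int n * k"] by (simp add: algebra_simps)
  next
    case (step2 k)
    then show ?case using assms[of "j + int n * (k - 1)"] by (simp add: algebra_simps)
  qed simp
  from this[of "i mod int n" "i div int n"] show ?thesis by simp
qed

text \<open>
  Being the coordinates of a polygon is a finite conjunction of polynomial inequations: the
  brackets at \<open>i + n\<close> are \<open>det N\<close> times those at \<open>i\<close>, so that one period of indices suffices.
\<close>

lemma nondegenerate_iff:
  fixes x :: "'k::field hcoords"
  assumes n: "n \<ge> 1"
  shows "nondegenerate n x \<longleftrightarrow> (\<exists>R\<in>ngons n. x \<in> hcoords_of n R)"
proof
  assume nd: "nondegenerate n x"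
  let ?u = "unroll n x"
  have inv: "invertible (snd x)" using nd by (simp add: nondegenerate_def invertible_det_nz)
  have br: "bracket (?u i) (?u (i + d)) \<noteq> 0" if "d \<in> {1, 2}" for i d
  proof -
    have "bracket (?u (i + int n)) (?u (i + int n + d)) = det (snd x) * bracket (?u i) (?u (i + d))" for i
      using unroll_shift[OF n inv, of i] unroll_shift[OF n inv, of "i + d"]
      by (simp add: bracket_mult algebra_simps)
    then have "bracket (?u i) (?u (i + d)) \<noteq> 0 \<longleftrightarrow>
        bracket (?u (i mod int n)) (?u (i mod int n + d)) \<noteq> 0"
      using inv by (intro periodic_mod) (simp add: invertible_det_nz)
    moreover have "i mod int n \<in> {0..<int n}" using n by simp
    ultimately show ?thesis using nd that unfolding nondegenerate_def by blast
  qed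
  have nz: "?u i \<noteq> 0" for i using br[of 1 i] by auto
  have "(\<lambda>i. abs_P1 (?u i), abs_PGL2 (snd x)) \<in> ngons n"
  proof -
    have "abs_P1 (?u (i + int n)) = pgl_act (abs_PGL2 (snd x)) (abs_P1 (?u i))" for i
      by (simp add: unroll_shift[OF n inv] pgl_act_abs inv nz)
    moreover have "abs_P1 (?u i) \<noteq> abs_P1 (?u (i + d))" if "d \<in> {1, 2}" for i d
      using br[OF that] nz by (simp add: abs_P1_eq_iff)
    from this[of 1] this[of 2] this[of 1 "i + 1" for i] have
      "abs_P1 (?u i) \<noteq> abs_P1 (?u (i + 1)) \<and> abs_P1 (?u (i + 1)) \<noteq> abs_P1 (?u (i + 2)) \<and>
       abs_P1 (?u i) \<noteq> abs_P1 (?u (i + 2))" for i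
      by (simp add: add.assoc)
    ultimately show ?thesis by (simp add: ngons_def)
  qed
  moreover have "x \<in> hcoords_of n (\<lambda>i. abs_P1 (?u i), abs_PGL2 (snd x))"
    using inv nz by (auto simp: hcoords_of_def case_prod_unfold unroll_base) (metis unroll_base atLeastLessThan_iff)
  ultimately show "\<exists>R\<in>ngons n. x \<in> hcoords_of n R" by blast
next
  assume "\<exists>R\<in>ngons n. x \<in> hcoords_of n R"
  then obtain R where R: "R \<in> ngons n" "x \<in> hcoords_of n R" by blast
  let ?u = "unroll n x"
  have inv: "invertible (snd x)" "snd R = abs_PGL2 (snd x)"
    and base: "\<And>i. i \<in> {0..<int n} \<Longrightarrow> fst x i \<noteq> 0 \<and> fst R i = abs_P1 (fst x i)"
    using R(2) by (auto simp: hcoords_of_def)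
  have shift: "fst R (i + int n) = pgl_act (snd R) (fst R i)" for i
    using R(1) by (auto simp: ngons_def)
  have u: "?u (int m) \<noteq> 0 \<and> fst R (int m) = abs_P1 (?u (int m))" for m
  proof (induction m rule: less_induct)
    case (less m)
    show ?case
    proof (cases "m < n")
      case True
      then show ?thesis using base[of "int m"] by (simp add: unroll_base)
    next
      case False
      then have m: "int m = int (m - n) + int n" "m - n < m" using n by auto
      show ?thesis using less[OF m(2)] inv
        unfolding m(1) shift unroll_shift[OF n inv(1)] by (simp add: pgl_act_abs)
    qed
  qed
  have "bracket (?u i) (?u (i + d)) \<noteq> 0" if i: "i \<in> {0..<int n}" "d \<in> {1, 2}" for i d
  proof -
    have "fst R i \<noteq> fst R (i + d)" using R(1) i by (auto simp: ngons_def)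
    moreover obtain a b where "i = int a" "i + d = int b"
      using i by (auto intro: that[of "nat i" "nat (i + 1)"] that[of "nat i" "nat (i + 2)"])
    ultimately show ?thesis using u[of a] u[of b] by (metis abs_P1_eq_iff)
  qed
  then show "nondegenerate n x"
    using inv by (simp add: nondegenerate_def invertible_det_nz)
qed

lemma cofinitely_nondegenerate:
  assumes n: "n \<ge> 1"
    and x: "\<And>h. h \<in> hcoord_funs n \<Longrightarrow> poly_fun (\<lambda>t. h (x t))"
    and s: "nondegenerate n (x s)"
  shows "finite {t. \<not> nondegenerate n (x t)}"
proof -
  have 1: "finite {t. det (snd (x t)) = 0}"
  proof (rule finite_zeros[where s = s])
    have "poly_fun (\<lambda>t. snd (x t) $ a $ b)" for a b
    proof -
      have "(\<lambda>(v, N). N $ a $ b) \<in> hcoord_funs n" by (auto simp: hcoord_funs_def)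
      from x[OF this] show ?thesis by (simp add: case_prod_unfold)
    qed
    then show "poly_fun (\<lambda>t. det (snd (x t)))"
      unfolding det_2 by (intro poly_fun_intros)
  qed (use s in \<open>simp add: nondegenerate_def\<close>)
  have 2: "finite {t. bracket (unroll n (x t) i) (unroll n (x t) (i + d)) = 0}"
    if "i \<in> {0..<int n}" "d \<in> {1, 2}" for i d
  proof (rule finite_zeros[where s = s])
    show "poly_fun (\<lambda>t. bracket (unroll n (x t) i) (unroll n (x t) (i + d)))"
      unfolding bracket_def using that
      by (intro poly_fun_intros poly_fun_unroll n x) auto
  qed (use s that in \<open>auto simp: nondegenerate_def\<close>)
  have "{t. \<not> nondegenerate n (x t)} \<subseteq> {t. det (snd (x t)) = 0} \<union>
      (\<Union>i\<in>{0..<int n}. \<Union>d\<in>{1, 2}. {t. bracket (unroll n (x t) i) (unroll n (x t) (i + d)) = 0})"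
    by (auto simp: nondegenerate_def)
  moreover have "finite ({t. det (snd (x t)) = 0} \<union>
      (\<Union>i\<in>{0..<int n}. \<Union>d\<in>{1, 2}. {t. bracket (unroll n (x t) i) (unroll n (x t) (i + d)) = 0}))"
    using 1 2 by blast
  ultimately show ?thesis by (rule finite_subset)
qed

lemma abs_P1_eqD:
  assumes "u \<noteq> 0" "v \<noteq> 0" "abs_P1 u = abs_P1 v"
  obtains k where "k \<noteq> 0" "v = k *s u"
proof -
  have "proportional u v" using assms by (simp add: abs_P1_eq_iff proportional_iff)
  then show ?thesis using that by (auto simp: proportional_def)
qed

text \<open>
  The domain of a rational map is open, and this is its form along a curve of polygons on which
  the cross-ratios are polynomials in \<open>t\<close>: if the map is defined at the polygon with parameter \<open>s\<close>,
  then for almost all \<open>t\<close> it is defined at some representative of the deformed class. The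
  representative is found by lifting the curve to homogeneous coordinates with the normal form,
  moving the normal form back to \<open>P\<close>. The map is given near \<open>P\<close> by polynomials \<open>f\<close>, whose values at one choice of
  coordinates \<open>(v, N)\<close> of \<open>P\<close> are known to be nondegenerate. As \<open>f\<close> need not be homogeneous,
  the lifted curve must pass through exactly these coordinates.
\<close>

lemma cofinitely_defined:
  fixes P :: "'k::field ngon" and c :: "'k \<Rightarrow> int \<Rightarrow> 'k"
  assumes T: "rational_map \<iota> n T" "P \<in> dom T" and n: "n \<ge> 1"
    and c: "\<And>i. poly_fun (\<lambda>t. c t i)" "c s = cross_ratio P"
  shows "finite {t. \<exists>Q\<in>ngons n. cross_ratio Q = c t \<and> mclass Q \<inter> dom T = {}}"
proof -
  have P: "P \<in> ngons n" using T unfolding rational_map_def by blast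
  \<comment> \<open>The polynomials around \<open>P\<close>, and the coordinates at which they are known to give a polygon.\<close>
  obtain f v N R where f: "polynomial_hmap \<iota> n f" "(v, N) \<in> hcoords_of n P"
      "R \<in> ngons n" "f (v, N) \<in> hcoords_of n R"
    and fT: "\<And>Q x R. Q \<in> ngons n \<Longrightarrow> x \<in> hcoords_of n Q \<Longrightarrow> R \<in> ngons n \<Longrightarrow>
      f x \<in> hcoords_of n R \<Longrightarrow> T Q = Some R"
    using T unfolding rational_map_def by (metis surj_pair)
  obtain B where B: "invertible B"
    "\<And>m. pgl_act (abs_PGL2 B) (fst P (int m)) = abs_P1 (frame (c s) m *v e0)"
    "pgl_conj (abs_PGL2 B) (snd P) = abs_PGL2 (frame (c s) n)"
    using normal_form[OF P] c(2) by metis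
  define A where "A = matrix_inv B"
  have A: "invertible A" "A ** B = mat 1" "matrix_inv A = B"
    using matrix_inv_props[OF B(1)] matrix_inv_matrix_inv[OF B(1)] by (simp_all add: A_def)
  have AB: "act (abs_PGL2 A) (act (abs_PGL2 B) P) = P"
    using A B(1) by (simp add: act_act act_one)
  have G: "invertible (frame (c s) m)" for m
    using cross_ratio_nonzero[OF P] c(2) by (intro invertible_frame) auto
  have Ge: "A *v (frame (c s) m *v e0) \<noteq> 0" "frame (c s) m *v e0 \<noteq> 0" for m
    using A(1) G base_points_nonzero(1) invertible_mult_eq_0 by blast+
  have "\<exists>k. k \<noteq> 0 \<and> v i = k *s (A *v (frame (c s) (nat i) *v e0))" if i: "i \<in> {0..<int n}" for i
  proof -
    have "v i \<noteq> 0" "fst P i = abs_P1 (v i)" using f(2) i by (auto simp: hcoords_of_def)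
    moreover have "fst P i = pgl_act (abs_PGL2 A) (pgl_act (abs_PGL2 B) (fst P i))"
      using AB by (metis act_def fst_conv)
    then have "fst P i = abs_P1 (A *v (frame (c s) (nat i) *v e0))"
      using B(2)[of "nat i"] i A(1) Ge by (simp add: pgl_act_abs)
    ultimately show ?thesis using Ge(1) by (metis abs_P1_eqD)
  qed
  then obtain l where l: "\<And>i. i \<in> {0..<int n} \<Longrightarrow>
      l i \<noteq> 0 \<and> v i = l i *s (A *v (frame (c s) (nat i) *v e0))"
    by metis
  have "\<exists>k. k \<noteq> 0 \<and> N = smat k (A ** frame (c s) n ** B)"
  proof -
    have "invertible N" "snd P = abs_PGL2 N" using f(2) by (auto simp: hcoords_of_def)
    moreover have "snd P = pgl_conj (abs_PGL2 A) (pgl_conj (abs_PGL2 B) (snd P))"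
      using AB by (metis act_def snd_conv)
    then have "snd P = abs_PGL2 (A ** frame (c s) n ** B)"
      using B(3) A G by (simp add: pgl_conj_abs)
    moreover have "invertible (A ** frame (c s) n ** B)" using A(1) B(1) G by (simp add: invertible_mult)
    ultimately show ?thesis by (metis abs_PGL2_eqD)
  qed
  then obtain m where m: "m \<noteq> 0" "N = smat m (A ** frame (c s) n ** B)" by blast
  \<comment> \<open>The scalars \<open>l i\<close> and \<open>m\<close> make the curve pass through \<open>(v, N)\<close>. Outside \<open>{0..<n}\<close> the
    coordinates are kept constant, so that \<open>x s\<close> equals \<open>(v, N)\<close> as a function too.\<close>
  define x where "x t = (\<lambda>i. if i \<in> {0..<int n} then l i *s (A *v (frame (c t) (nat i) *v e0)) else v i,
      smat m (A ** frame (c t) n ** B))" for t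
  have xs: "x s = (v, N)" using l m by (auto simp: x_def)
  have "poly_fun (\<lambda>t. h (x t))" if "h \<in> hcoord_funs n" for h
    using that unfolding hcoord_funs_def
    by (auto simp: x_def smat_def matrix_vector_mult_def matrix_matrix_mult_def sum_2
        intro!: poly_fun_intros poly_fun_frame c(1))
  then have "poly_fun (\<lambda>t. h (f (x t)))" if "h \<in> hcoord_funs n" for h
    using f(1) that poly_fun_of_polyfuns[of "h \<circ> f" \<iota> "hcoord_funs n" x]
    by (auto simp: polynomial_hmap_def)
  then have "finite {t. \<not> nondegenerate n (f (x t))}"
    using f(3,4) xs n by (intro cofinitely_nondegenerate[where s = s]) (auto simp: nondegenerate_iff)
  moreover have "mclass Q \<inter> dom T \<noteq> {}"
    if t: "nondegenerate n (f (x t))" and Q: "Q \<in> ngons n" "cross_ratio Q = c t" for Q t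
  proof -
    obtain R where R: "R \<in> ngons n" "f (x t) \<in> hcoords_of n R"
      using t n by (auto simp: nondegenerate_iff)
    obtain C where C: "invertible C"
      "\<And>m. pgl_act (abs_PGL2 C) (fst Q (int m)) = abs_P1 (frame (c t) m *v e0)"
      "pgl_conj (abs_PGL2 C) (snd Q) = abs_PGL2 (frame (c t) n)"
      using normal_form[OF Q(1)] Q(2) by metis
    define S where "S = act (abs_PGL2 A) (act (abs_PGL2 C) Q)"
    have S: "S \<in> ngons n" "S \<in> mclass Q"
      using act_ngons[OF act_ngons[OF Q(1)]] mem_mclass[of S] by (simp_all add: S_def mclass_act)
    have G: "invertible (frame (c t) m)" for m
      using cross_ratio_nonzero[OF Q(1)] Q(2) by (intro invertible_frame) auto
    have Ge: "A *v (frame (c t) m *v e0) \<noteq> 0" "frame (c t) m *v e0 \<noteq> 0" for m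
      using A(1) G base_points_nonzero(1) invertible_mult_eq_0 by blast+
    have "fst S i = abs_P1 (l i *s (A *v (frame (c t) (nat i) *v e0))) \<and>
        l i *s (A *v (frame (c t) (nat i) *v e0)) \<noteq> 0" if i: "i \<in> {0..<int n}" for i
    proof -
      have "fst S i = abs_P1 (A *v (frame (c t) (nat i) *v e0))"
        using C(2)[of "nat i"] i A(1) Ge by (simp add: S_def act_def pgl_act_abs)
      moreover have "l i *s (A *v (frame (c t) (nat i) *v e0)) \<noteq> 0" using l[OF i] Ge(1) by simp
      ultimately show ?thesis using Ge(1)
        by (simp add: abs_P1_eq_iff) (simp add: bracket_def)
    qed
    moreover have "snd S = abs_PGL2 (smat m (A ** frame (c t) n ** B))"
        "invertible (smat m (A ** frame (c t) n ** B))"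
      using C(3) A B(1) G m(1)
      by (simp_all add: S_def act_def pgl_conj_abs abs_PGL2_smat invertible_mult)
    ultimately have "x t \<in> hcoords_of n S" by (auto simp: hcoords_of_def x_def)
    from fT[OF S(1) this R] S(2) show ?thesis by blast
  qed
  then have "{t. \<exists>Q\<in>ngons n. cross_ratio Q = c t \<and> mclass Q \<inter> dom T = {}} \<subseteq>
      {t. \<not> nondegenerate n (f (x t))}"
    by blast
  ultimately show ?thesis using finite_subset by blast
qed


section \<open>The expansion of the trace along a linear symmetry\<close>

lemma action_one:
  assumes "rational_action \<iota> n \<rho>" "\<rho> 1 x \<noteq> None"
  shows "\<rho> 1 x = Some x"
  using assms unfolding rational_action_def by blast

lemma deformed_eq:
  assumes "\<rho> t (mclass P) = Some (mclass Q)"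
  shows "deformed \<rho> P i t = cross_ratio Q i"
  using assms by (simp add: deformed_def class_cross_ratio_mclass)

lemma cross_ratio_deformed:
  assumes "linear_symmetry n \<rho>" "P \<in> ngons n" "\<rho> 1 (mclass P) \<noteq> None"
    and Q: "\<rho> t (mclass P) = Some (mclass Q)"
  shows "cross_ratio Q i = deformed \<rho> P i 1 + deformed_deriv \<rho> P i 1 * (t - 1)"
proof -
  have "\<rho> t (mclass P) \<noteq> None" using Q by blast
  then have "deformed \<rho> P i t = deformed \<rho> P i 1 + deformed_deriv \<rho> P i 1 * (t - 1)"
    using assms(1-3) unfolding linear_symmetry_def by blast
  then show ?thesis unfolding deformed_eq[where \<rho> = \<rho> and t = t, OF Q] .
qed

text \<open>
  Along a linear symmetry every cross-ratio is an affine function of \<open>t - 1\<close>, and the \<open>H_sum\<close> are by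
  construction the coefficients of the expanded trace.
\<close>

lemma trace_deformed:
  assumes \<rho>: "rational_action \<iota> n \<rho>" "linear_symmetry n \<rho>" and n: "n \<ge> 1"
    and P: "P \<in> ngons n" "\<rho> 1 (mclass P) \<noteq> None"
    and Q: "\<rho> t (mclass P) = Some (mclass Q)"
  shows "trace (monodromy_matrix n Q) = (\<Sum>k = 0..n div 2. H_sum n \<rho> k P * (t - 1) ^ k)"
proof -
  have one: "deformed \<rho> P i 1 \<noteq> 0" for i
    using deformed_eq[where \<rho> = \<rho> and t = 1 and Q = P, OF action_one[OF \<rho>(1) P(2)]]
      cross_ratio_nonzero[OF P(1)] by simp
  have "cross_ratio Q = (\<lambda>i. deformed \<rho> P i 1 + deformed_deriv \<rho> P i 1 * (t - 1))"
    by (rule ext) (rule cross_ratio_deformed[where n = n, OF \<rho>(2) P Q])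
  then show ?thesis
    unfolding monodromy_matrix_frame
    by (simp add: trace_frame[OF n] signed_sum_expansion[OF one] H_sum_def)
qed


section \<open>Conservation of the coefficients\<close>

text \<open>
  Locally, the deformation is given by quotients whose numerators and denominators are
  polynomials in \<open>t\<close> that do not vanish at \<open>s\<close>.
\<close>

lemma deformation_cofinitely_defined:
  assumes \<rho>: "rational_family \<iota> n \<rho>" "\<rho> s x \<noteq> None"
  shows "finite {t. \<rho> t x = None}"
proof -
  obtain N D where ND: "\<And>i. i \<in> {1..int n} \<Longrightarrow> N i \<in> polyfuns \<iota> (tc_funs n) \<and> D i \<in> polyfuns \<iota> (tc_funs n)"
    "\<And>i. i \<in> {1..int n} \<Longrightarrow> N i (s, class_cross_ratio x) \<noteq> 0 \<and> D i (s, class_cross_ratio x) \<noteq> 0"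
    "\<And>t. t \<noteq> 0 \<Longrightarrow> x \<in> moduli n \<Longrightarrow>
        (\<forall>i\<in>{1..int n}. N i (t, class_cross_ratio x) \<noteq> 0 \<and> D i (t, class_cross_ratio x) \<noteq> 0) \<Longrightarrow>
        \<rho> t x \<noteq> None"
    using \<rho> unfolding rational_family_def by (smt (verit) option.distinct(1))
  have x: "x \<in> moduli n" using \<rho> unfolding rational_family_def by blast
  have fin: "finite {t. h (t, class_cross_ratio x) = 0}"
    if "h \<in> polyfuns \<iota> (tc_funs n)" "h (s, class_cross_ratio x) \<noteq> 0" for h
  proof (rule finite_zeros[where s = s])
    show "poly_fun (\<lambda>t. h (t, class_cross_ratio x))"
      using that(1) by (rule poly_fun_of_polyfuns) (auto simp: tc_funs_def intro: poly_fun_intros)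
  qed fact
  have "{t. \<rho> t x = None} \<subseteq> {0} \<union> (\<Union>i\<in>{1..int n}.
      {t. N i (t, class_cross_ratio x) = 0} \<union> {t. D i (t, class_cross_ratio x) = 0})"
    using ND(3) x by blast
  moreover have "finite ({0} \<union> (\<Union>i\<in>{1..int n}.
      {t. N i (t, class_cross_ratio x) = 0} \<union> {t. D i (t, class_cross_ratio x) = 0}))"
    using ND(1,2) fin by blast
  ultimately show ?thesis by (rule finite_subset)
qed

text \<open>
  The choice of a representative in the definition of \<open>induced\<close> is immaterial, because the
  transformation commutes with the projective action.
\<close>

lemma induced_mclass:
  assumes T: "polygonal_transformation \<iota> n T" "T P = Some Q"
  shows "induced T (mclass P) = Some (mclass Q)"
proof -
  define S where "S = (SOME R. R \<in> mclass P \<inter> dom T)"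
  have P: "P \<in> mclass P \<inter> dom T" using T(2) mem_mclass by blast
  then have "S \<in> mclass P \<inter> dom T" unfolding S_def by (rule someI)
  then obtain X where X: "S = act X P" "act X P \<in> dom T"
    unfolding mclass_def by blast
  then have "T (act X P) = Some (act X Q)"
    using T unfolding polygonal_transformation_def by (metis domI option.sel)
  moreover have "induced T (mclass P) = Some (mclass (the (T S)))"
    using P unfolding induced_def S_def[symmetric] by auto
  ultimately show ?thesis using X by (simp add: mclass_act)
qed

lemma trace_conj:
  fixes A M :: "'k::field ^ 2 ^ 2"
  assumes "invertible A"
  shows "trace (A ** M ** matrix_inv A) = trace M"
proof -
  have "trace (A ** M ** matrix_inv A) = trace (matrix_inv A ** (A ** M))"
    by (rule trace_mul_sym)
  also have "matrix_inv A ** (A ** M) = M"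
    using matrix_inv_props[OF assms] by (simp add: matrix_mul_assoc)
  finally show ?thesis .
qed

lemma coefficients_unique:
  fixes a b :: "nat \<Rightarrow> 'k::field"
  assumes "infinite S" "\<And>s. s \<in> S \<Longrightarrow> (\<Sum>k = 0..m. a k * s ^ k) = (\<Sum>k = 0..m. b k * s ^ k)"
    and "k \<le> m"
  shows "a k = b k"
proof -
  define p where "p = (\<Sum>k = 0..m. monom (a k - b k) k)"
  have "poly p s = 0" if "s \<in> S" for s
    using assms(2)[OF that] by (simp add: p_def poly_sum poly_monom left_diff_distrib sum_subtractf)
  then have "S \<subseteq> {s. poly p s = 0}" by blast
  then have "p = 0" using assms(1) poly_roots_finite finite_subset by blast
  then have "coeff p k = 0" by simp
  moreover have "coeff p k = a k - b k"
    using assms(3) by (simp add: p_def coeff_sum)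
  ultimately show ?thesis by simp
qed

text \<open>
  For almost every \<open>t\<close>, the deformations of \<open>P\<close> and of \<open>Q\<close> exist and \<open>T\<close> is defined at a
  representative of the deformed \<open>P\<close>. Commutation then identifies the deformation of \<open>Q\<close> with the
  image of the deformation of \<open>P\<close>, so both have the same trace. Thus the trace polynomials of
  \<open>P\<close> and \<open>Q\<close> agree at infinitely many values of \<open>t - 1\<close>.
\<close>

lemma H_sum_conserved:
  fixes P :: "'k::field ngon"
  assumes inf: "infinite (UNIV :: 'k set)" and n: "n \<ge> 1"
    and T: "polygonal_transformation \<iota> n T" "preserves_monodromy n T"
    and \<rho>: "scaling_symmetry \<iota> n T \<rho>" "linear_symmetry n \<rho>"
    and P: "\<rho> 1 (mclass P) \<noteq> None"
    and Q: "T P = Some Q" "\<rho> 1 (mclass Q) \<noteq> None"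
    and k: "k \<le> n div 2"
  shows "H_sum n \<rho> k Q = H_sum n \<rho> k P"
proof -
  have act: "rational_action \<iota> n \<rho>" using \<rho>(1) by (simp add: scaling_symmetry_def)
  then have fam: "rational_family \<iota> n \<rho>" by (simp add: rational_action_def)
  have comm: "y = y'" if "(induced T \<circ>\<^sub>m \<rho> t) x = Some y" "(\<rho> t \<circ>\<^sub>m induced T) x = Some y'" for t x y y'
    using \<rho>(1) that unfolding scaling_symmetry_def by meson
  have rat: "rational_map \<iota> n T"
    using T(1) unfolding polygonal_transformation_def birational_map_def by blast
  then have ngons: "P \<in> ngons n" "Q \<in> ngons n"
    using Q(1) unfolding rational_map_def by (blast intro: ranI)+
  define c where "c t i = deformed \<rho> P i 1 + deformed_deriv \<rho> P i 1 * (t - 1)" for t i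
  have c: "cross_ratio R = c t" if "\<rho> t (mclass P) = Some (mclass R)" for R t
    unfolding c_def by (rule ext) (rule cross_ratio_deformed[where n = n, OF \<rho>(2) ngons(1) P that])
  define bad where "bad = {t. \<rho> t (mclass P) = None} \<union> {t. \<rho> t (mclass Q) = None} \<union>
      {t. \<exists>R\<in>ngons n. cross_ratio R = c t \<and> mclass R \<inter> dom T = {}}"
  have "finite {t. \<exists>R\<in>ngons n. cross_ratio R = c t \<and> mclass R \<inter> dom T = {}}"
  proof (rule cofinitely_defined[OF rat _ n])
    show "P \<in> dom T" using Q(1) by blast
    show "poly_fun (\<lambda>t. c t i)" for i unfolding c_def by (intro poly_fun_intros)
    show "c 1 = cross_ratio P" using c[OF action_one[OF act P]] by simp
  qed
  then have "finite bad"
    unfolding bad_def using deformation_cofinitely_defined[OF fam] P Q(2) by blast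
  then have "infinite (- bad)" using inf by (metis Compl_eq_Diff_UNIV finite_Diff2)
  then have "infinite ((\<lambda>t. t - 1) ` (- bad))" by (simp add: finite_image_iff)
  moreover have "(\<Sum>k = 0..n div 2. H_sum n \<rho> k Q * s ^ k) = (\<Sum>k = 0..n div 2. H_sum n \<rho> k P * s ^ k)"
    if "s \<in> (\<lambda>t. t - 1) ` (- bad)" for s
  proof -
    from that obtain t where t: "s = t - 1" "t \<notin> bad" by blast
    then obtain y where y: "\<rho> t (mclass P) = Some y" by (auto simp: bad_def)
    then have "y \<in> moduli n" using fam unfolding rational_family_def by blast
    then obtain P' where P': "P' \<in> ngons n" "y = mclass P'" by (auto simp: moduli_def)
    then have "mclass P' \<inter> dom T \<noteq> {}" using t(2) c y by (auto simp: bad_def)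
    then obtain X R where XR: "T (act X P') = Some R" by (auto simp: mclass_def)
    have "induced T (mclass P') = Some (mclass R)"
      using induced_mclass[OF T(1) XR] by (simp add: mclass_act)
    then have 1: "(induced T \<circ>\<^sub>m \<rho> t) (mclass P) = Some (mclass R)"
      using y P'(2) by (simp add: map_comp_def)
    obtain z where z: "\<rho> t (mclass Q) = Some z" using t by (auto simp: bad_def)
    then have "(\<rho> t \<circ>\<^sub>m induced T) (mclass P) = Some z"
      using induced_mclass[OF T(1) Q(1)] by (simp add: map_comp_def)
    with comm[OF 1] z have R: "\<rho> t (mclass Q) = Some (mclass R)" by blast
    obtain A where "invertible A"
      "monodromy_matrix n R = A ** monodromy_matrix n (act X P') ** matrix_inv A"
      using T(2) XR unfolding preserves_monodromy_def by blast
    then have "trace (monodromy_matrix n R) = trace (monodromy_matrix n P')"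
      by (simp add: trace_conj monodromy_matrix_act)
    then show ?thesis
      using trace_deformed[OF act \<rho>(2) n ngons(1) P, of t P'] y P'(2)
        trace_deformed[OF act \<rho>(2) n ngons(2) Q(2) R] t(1) by simp
  qed
  ultimately show ?thesis using k by (rule coefficients_unique)
qed

text \<open>
  The deformation, and with it its derivative, depends only on the class of the polygon.
\<close>

lemma H_sum_act: "H_sum n \<rho> k (act X P) = H_sum n \<rho> k P"
proof -
  have "deformed \<rho> (act X P) = deformed \<rho> P" by (intro ext) (simp add: deformed_def mclass_act)
  then show ?thesis by (simp add: H_sum_def deformed_deriv_def mclass_act)
qed

theorem proposition4p4:
  fixes \<iota> :: "'a::field \<Rightarrow> 'k::field"
    and n :: nat
    and T :: "'k ngon \<rightharpoonup> 'k ngon"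
    and \<rho> :: "'k \<Rightarrow> 'k ngon set \<rightharpoonup> 'k ngon set"
    and P :: "'k ngon"
  assumes "field_embedding \<iota>" and "infinite (UNIV :: 'k set)"
    and "n \<ge> 1"
    and "polygonal_transformation \<iota> n T"
    and "scaling_symmetry \<iota> n T \<rho>"
    and "linear_symmetry n \<rho>"
    and "P \<in> ngons n" and "\<rho> 1 (mclass P) \<noteq> None"
  shows "(preserves_monodromy n T \<longrightarrow>
            (\<forall>Q. T P = Some Q \<and> \<rho> 1 (mclass Q) \<noteq> None \<longrightarrow>
               (\<forall>k \<le> n div 2. H_sum n \<rho> k Q = H_sum n \<rho> k P))) \<and>
         (\<forall>A. \<forall>k \<le> n div 2. H_sum n \<rho> k (act A P) = H_sum n \<rho> k P) \<and>
         (\<forall>t P\<^sub>t. t \<noteq> 0 \<and> P\<^sub>t \<in> ngons n \<and> \<rho> t (mclass P) = Some (mclass P\<^sub>t) \<longrightarrow>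
            trace (monodromy_matrix n P\<^sub>t) = (\<Sum>k = 0..n div 2. H_sum n \<rho> k P * (t - 1) ^ k))"
proof (intro conjI impI allI)
  fix Q k
  assume "preserves_monodromy n T" "T P = Some Q \<and> \<rho> 1 (mclass Q) \<noteq> None" "k \<le> n div 2"
  then show "H_sum n \<rho> k Q = H_sum n \<rho> k P"
    using H_sum_conserved[OF assms(2-4) _ assms(5,6,8)] by blast
next
  fix A k
  show "H_sum n \<rho> k (act A P) = H_sum n \<rho> k P" by (rule H_sum_act)
next
  fix t P\<^sub>t
  assume "t \<noteq> 0 \<and> P\<^sub>t \<in> ngons n \<and> \<rho> t (mclass P) = Some (mclass P\<^sub>t)"
  moreover have "rational_action \<iota> n \<rho>" using assms(5) by (simp add: scaling_symmetry_def)
  ultimately show "trace (monodromy_matrix n P\<^sub>t) = (\<Sum>k = 0..n div 2. H_sum n \<rho> k P * (t - 1) ^ k)"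
    using trace_deformed assms(3,6-8) by blast
qed

end
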